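(* Let $P=\langle x_1,\ldots ,x_n\mid r_1,\ldots ,r_m\rangle$ be a finite presentation that is DR in all directions. Then the inclusion induced homomorphism $G(P_S)\to G(P)$ is injective for every subset $S$ of the generators.
   Context: For a presentation $P=\langle x_1,\ldots ,x_n\mid r_1,\ldots ,r_m\rangle$, $K(P)$ is the 2-complex with one vertex, one oriented edge for each generator, and one 2-cell for each relator, attached along the relator word; $G(P)=\pi_1(K(P))$ is the group presented by $P$. A map between 2-complexes is combinatorial if it maps open cells homeomorphically to open cells. A spherical diagram over $K(P)$ is a combinatorial map $f\colon C\to K(P)$ where $C$ is a 2-sphere with a cell structure. The label of a cell $c$ of $C$ is $f(c)$; an edge is thus labeled by a generator. A folding edge of $C$ is an edge $e$ such that the two 2-cells of $C$ that contain $e$ in their boundary map to the same 2-cell of $K(P)$ with opposite orientations by folding over $e$ (the two cells are mirror images of each other across $e$: in both, $e$ corresponds to the same letter position of the relator). $P$ is DR in all directions if, for each $i=1,\ldots ,n$, every spherical diagram $f\colon C\to K(P)$ that contains an edge labeled $x_i$ also contains a folding edge with label $x_i$. For a subset $S$ of the generators, $P_S$ is the sub-presentation carried by $S$: its generators are $S$ and its relators are the relators of $P$ that involve only generators from $S$. *)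

theory Defs
  imports "HOL-Algebra.Group" "HOL-Combinatorics.Orbits"
begin

subsection \<open>Presentations and the groups they present\<close>

text \<open>
  The letter \<open>(x, True)\<close> stands for the generator \<open>x\<close> and \<open>(x, False)\<close> for its inverse.
  Relators are arbitrary words, not assumed to be (cyclically) reduced. They form a list, so
  that equal relators at different list positions give different 2-cells of \<open>K(P)\<close>.
\<close>

type_synonym 'a letter = "'a \<times> bool"
type_synonym 'a word = "'a letter list"

record 'a presentation =
  gens :: "'a set"
  rels :: "'a word list"

definition words_over :: "'a set \<Rightarrow> 'a word set" where
  "words_over X = lists (X \<times> UNIV)"

definition finite_presentation :: "'a presentation \<Rightarrow> bool" where
  "finite_presentation P \<longleftrightarrow> finite (gens P) \<and> set (rels P) \<subseteq> words_over (gens P)"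

definition sub_presentation :: "'a presentation \<Rightarrow> 'a set \<Rightarrow> 'a presentation" where
  "sub_presentation P S = \<lparr>gens = S, rels = filter (\<lambda>r. r \<in> words_over S) (rels P)\<rparr>"

definition inv_letter :: "'a letter \<Rightarrow> 'a letter" where
  "inv_letter l = (fst l, \<not> snd l)"

text \<open>
  Two words represent the same element of \<open>G(P)\<close> if they are related by insertions and
  deletions of pairs of mutually inverse letters and of relators.
\<close>

inductive word_equiv :: "'a presentation \<Rightarrow> 'a word \<Rightarrow> 'a word \<Rightarrow> bool" for P where
  refl: "u \<in> words_over (gens P) \<Longrightarrow> word_equiv P u u"
| sym: "word_equiv P u v \<Longrightarrow> word_equiv P v u"
| trans: "word_equiv P u v \<Longrightarrow> word_equiv P v w \<Longrightarrow> word_equiv P u w"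
| cancel: "u \<in> words_over (gens P) \<Longrightarrow> v \<in> words_over (gens P) \<Longrightarrow> fst l \<in> gens P
    \<Longrightarrow> word_equiv P (u @ [l, inv_letter l] @ v) (u @ v)"
| relator: "u \<in> words_over (gens P) \<Longrightarrow> v \<in> words_over (gens P) \<Longrightarrow> r \<in> set (rels P)
    \<Longrightarrow> word_equiv P (u @ r @ v) (u @ v)"

definition word_rel :: "'a presentation \<Rightarrow> ('a word \<times> 'a word) set" where
  "word_rel P = {(u, v). word_equiv P u v}"

definition presented_group :: "'a presentation \<Rightarrow> 'a word set monoid" where
  "presented_group P =
    \<lparr>carrier = words_over (gens P) // word_rel P,
     monoid.mult = (\<lambda>A B. word_rel P `` {u @ v | u v. u \<in> A \<and> v \<in> B}),
     monoid.one = word_rel P `` {[]}\<rparr>"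

text \<open>
  An element of \<open>G(P\<^sub>S)\<close> is a class \<open>A\<close> of words over \<open>S\<close>. It is sent to the class of the
  same words in \<open>G(P)\<close>; see \<open>inclusion_map_class\<close> and \<open>inclusion_map_hom\<close> below.
\<close>

definition inclusion_map :: "'a presentation \<Rightarrow> 'a word set \<Rightarrow> 'a word set" where
  "inclusion_map P A = word_rel P `` A"


subsection \<open>Spherical diagrams over \<open>K(P)\<close>\<close>

text \<open>
  A cell structure on the oriented 2-sphere with at least one edge is encoded by its
  combinatorial map. Each edge gives two darts (its two orientations), exchanged by \<open>flip\<close>.
  Each dart lies on the boundary of the 2-cell to its left, and \<open>face_next d\<close> is the dart
  following \<open>d\<close> on the boundary path of that 2-cell. So 2-cells are the orbits of \<open>face_next\<close>,
  edges are the orbits of \<open>flip\<close>, and vertices (sets of darts with a common starting point) are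
  the orbits of \<open>face_next \<circ> flip\<close>. The surface is a sphere iff it is connected with
  Euler characteristic 2.

  The combinatorial map \<open>f : C \<rightarrow> K(P)\<close> is recorded on darts. The 2-cell to the left
  of \<open>d\<close> is mapped to the 2-cell of the relator \<open>rels P ! cell d\<close>; \<open>orient d\<close> says whether the
  orientation is preserved there; and \<open>pos d\<close> is the position in the relator to which the
  occurrence \<open>d\<close> of its edge on the boundary of that 2-cell corresponds. The position is part
  of the data, since it is not determined by edge labels if the relator is a proper power.

  Dart names are irrelevant and there are finitely many, so they can be taken to be numbers.
  The sphere with a single vertex, no edges and one 2-cell (which can map to \<open>K(P)\<close>
  if there is an empty relator) is not represented; it has no edges, so it is immaterial for
  the notion of being DR.
\<close>

record diagram =
  darts :: "nat set"
  flip :: "nat \<Rightarrow> nat"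
  face_next :: "nat \<Rightarrow> nat"
  cell :: "nat \<Rightarrow> nat"
  pos :: "nat \<Rightarrow> nat"
  orient :: "nat \<Rightarrow> bool"

definition orbits_on :: "(nat \<Rightarrow> nat) \<Rightarrow> nat set \<Rightarrow> nat set set" where
  "orbits_on p D = orbit p ` D"

definition spherical_map :: "diagram \<Rightarrow> bool" where
  "spherical_map C \<longleftrightarrow>
    finite (darts C) \<and>
    flip C permutes darts C \<and>
    (\<forall>d\<in>darts C. flip C d \<noteq> d \<and> flip C (flip C d) = d) \<and>
    face_next C permutes darts C \<and>
    (\<forall>d\<in>darts C. \<forall>d'\<in>darts C.
      (d, d') \<in> {(a, b). a \<in> darts C \<and> (b = flip C a \<or> b = face_next C a)}\<^sup>*) \<and>
    card (orbits_on (face_next C \<circ> flip C) (darts C)) + card (orbits_on (face_next C) (darts C))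
      = card (orbits_on (flip C) (darts C)) + 2"

definition dart_letter :: "'a presentation \<Rightarrow> diagram \<Rightarrow> nat \<Rightarrow> 'a letter" where
  "dart_letter P C d =
    (let l = rels P ! cell C d ! pos C d in if orient C d then l else inv_letter l)"

definition edge_label :: "'a presentation \<Rightarrow> diagram \<Rightarrow> nat \<Rightarrow> 'a" where
  "edge_label P C d = fst (dart_letter P C d)"

text \<open>
  The boundary path of each 2-cell runs exactly once through all letter positions of the
  relator, forwards or backwards according to the orientation, and the letters assigned to an
  edge from its two sides agree.
\<close>

definition spherical_diagram :: "'a presentation \<Rightarrow> diagram \<Rightarrow> bool" where
  "spherical_diagram P C \<longleftrightarrow>
    spherical_map C \<and>
    (\<forall>d\<in>darts C.
      let d' = face_next C d; n = length (rels P ! cell C d) in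
        cell C d < length (rels P) \<and>
        cell C d' = cell C d \<and>
        orient C d' = orient C d \<and>
        bij_betw (pos C) (orbit (face_next C) d) {..<n} \<and>
        (if orient C d then pos C d' = (pos C d + 1) mod n
         else pos C d = (pos C d' + 1) mod n) \<and>
        dart_letter P C (flip C d) = inv_letter (dart_letter P C d))"

text \<open>
  The two 2-cells at a folding edge are automatically distinct, because \<open>orient\<close> is constant
  on each 2-cell.
\<close>

definition folding_edge :: "diagram \<Rightarrow> nat \<Rightarrow> bool" where
  "folding_edge C d \<longleftrightarrow>
    cell C (flip C d) = cell C d \<and>
    pos C (flip C d) = pos C d \<and>
    orient C (flip C d) \<noteq> orient C d"

definition DR_all_directions :: "'a presentation \<Rightarrow> bool" where
  "DR_all_directions P \<longleftrightarrow>
    (\<forall>x\<in>gens P. \<forall>C. spherical_diagram P C \<longrightarrow>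
      (\<exists>d\<in>darts C. edge_label P C d = x) \<longrightarrow>
      (\<exists>d\<in>darts C. edge_label P C d = x \<and> folding_edge C d))"


subsection \<open>The presented group is a group, and the inclusion map is a homomorphism\<close>

lemma words_over_simps [simp]:
  "[] \<in> words_over X"
  "l # u \<in> words_over X \<longleftrightarrow> fst l \<in> X \<and> u \<in> words_over X"
  "u @ v \<in> words_over X \<longleftrightarrow> u \<in> words_over X \<and> v \<in> words_over X"
  by (auto simp: words_over_def mem_Times_iff)

lemma fst_inv_letter [simp]: "fst (inv_letter l) = fst l"
  by (simp add: inv_letter_def)

lemma inv_letter_inv_letter [simp]: "inv_letter (inv_letter l) = l"
  by (simp add: inv_letter_def)

lemma word_equiv_words:
  assumes "finite_presentation P" "word_equiv P u v"
  shows "u \<in> words_over (gens P) \<and> v \<in> words_over (gens P)"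
  using assms(2,1) by induction (auto simp: finite_presentation_def)

lemma equiv_word_rel:
  assumes "finite_presentation P"
  shows "equiv (words_over (gens P)) (word_rel P)"
  using word_equiv_words[OF assms]
  by (intro equivI refl_onI symI transI)
     (auto simp: word_rel_def intro: word_equiv.intros)

lemma word_equiv_context:
  assumes "word_equiv P u v" "a \<in> words_over (gens P)" "b \<in> words_over (gens P)"
    "finite_presentation P"
  shows "word_equiv P (a @ u @ b) (a @ v @ b)"
  using assms
proof induction
  case (cancel u v l)
  then show ?case using word_equiv.cancel[of "a @ u" P "v @ b" l] by simp
next
  case (relator u v r)
  then show ?case using word_equiv.relator[of "a @ u" P "v @ b" r] by simp
next
  case (refl u)
  then show ?case by (intro word_equiv.refl) simp
qed (blast intro: word_equiv.sym word_equiv.trans)+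

lemma word_equiv_append:
  assumes "finite_presentation P" "word_equiv P u u'" "word_equiv P v v'"
  shows "word_equiv P (u @ v) (u' @ v')"
proof -
  have "word_equiv P (u @ v) (u' @ v)"
    using word_equiv_context[of P u u' "[]" v] assms word_equiv_words by fastforce
  moreover have "word_equiv P (u' @ v) (u' @ v')"
    using word_equiv_context[of P v v' u' "[]"] assms word_equiv_words by fastforce
  ultimately show ?thesis by (rule word_equiv.trans)
qed

lemma presented_group_mult:
  assumes P: "finite_presentation P"
    and "u \<in> words_over (gens P)" "v \<in> words_over (gens P)"
  shows "word_rel P `` {u} \<otimes>\<^bsub>presented_group P\<^esub> word_rel P `` {v} = word_rel P `` {u @ v}"
proof (intro equalityI subsetI)
  fix w
  assume "w \<in> word_rel P `` {u} \<otimes>\<^bsub>presented_group P\<^esub> word_rel P `` {v}"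
  then obtain u' v' where "word_equiv P u u'" "word_equiv P v v'" "word_equiv P (u' @ v') w"
    by (auto simp: presented_group_def word_rel_def)
  then have "word_equiv P (u @ v) w"
    using word_equiv_append[OF P] word_equiv.trans by blast
  then show "w \<in> word_rel P `` {u @ v}" by (simp add: word_rel_def)
next
  fix w
  assume "w \<in> word_rel P `` {u @ v}"
  then show "w \<in> word_rel P `` {u} \<otimes>\<^bsub>presented_group P\<^esub> word_rel P `` {v}"
    using assms by (auto simp: presented_group_def word_rel_def intro: word_equiv.refl)
qed

lemma word_class_closed:
  "u \<in> words_over (gens P) \<Longrightarrow> word_rel P `` {u} \<in> carrier (presented_group P)"
  by (simp add: presented_group_def quotientI)

lemma presented_group_cases:
  assumes "A \<in> carrier (presented_group P)"
  obtains u where "u \<in> words_over (gens P)" "A = word_rel P `` {u}"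
  using assms by (auto simp: presented_group_def elim: quotientE)

lemma word_equiv_inverse:
  assumes P: "finite_presentation P" and "u \<in> words_over (gens P)"
  shows "rev (map inv_letter u) \<in> words_over (gens P) \<and>
    word_equiv P (rev (map inv_letter u) @ u) []"
  using assms(2)
proof (induction u)
  case Nil
  then show ?case by (simp add: word_equiv.refl)
next
  case (Cons l u)
  let ?w = "rev (map inv_letter u)"
  have "word_equiv P (?w @ [inv_letter l, inv_letter (inv_letter l)] @ u) (?w @ u)"
    using Cons by (intro word_equiv.cancel) auto
  then show ?case using Cons by (auto intro: word_equiv.trans)
qed

lemma group_presented_group:
  assumes P: "finite_presentation P"
  shows "group (presented_group P)"
proof (rule groupI)
  have one: "\<one>\<^bsub>presented_group P\<^esub> = word_rel P `` {[]}"
    by (simp add: presented_group_def)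
  show "\<one>\<^bsub>presented_group P\<^esub> \<in> carrier (presented_group P)"
    by (simp add: one word_class_closed)
  fix A assume A: "A \<in> carrier (presented_group P)"
  then obtain u where u: "u \<in> words_over (gens P)" "A = word_rel P `` {u}"
    by (rule presented_group_cases)
  show "\<one>\<^bsub>presented_group P\<^esub> \<otimes>\<^bsub>presented_group P\<^esub> A = A"
    using u by (simp add: one presented_group_mult[OF P])
  have "word_rel P `` {rev (map inv_letter u) @ u} = word_rel P `` {[]}"
    using word_equiv_inverse[OF P u(1)]
    by (intro equiv_class_eq[OF equiv_word_rel[OF P]]) (simp add: word_rel_def)
  then show "\<exists>B\<in>carrier (presented_group P). B \<otimes>\<^bsub>presented_group P\<^esub> A = \<one>\<^bsub>presented_group P\<^esub>"
    using word_equiv_inverse[OF P u(1)] u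
    by (intro bexI[of _ "word_rel P `` {rev (map inv_letter u)}"])
       (auto simp: one presented_group_mult[OF P] word_class_closed)
  fix B assume "B \<in> carrier (presented_group P)"
  then obtain v where v: "v \<in> words_over (gens P)" "B = word_rel P `` {v}"
    by (rule presented_group_cases)
  show "A \<otimes>\<^bsub>presented_group P\<^esub> B \<in> carrier (presented_group P)"
    using u v by (simp add: presented_group_mult[OF P] word_class_closed)
  fix D assume "D \<in> carrier (presented_group P)"
  then obtain w where w: "w \<in> words_over (gens P)" "D = word_rel P `` {w}"
    by (rule presented_group_cases)
  show "A \<otimes>\<^bsub>presented_group P\<^esub> B \<otimes>\<^bsub>presented_group P\<^esub> D =
      A \<otimes>\<^bsub>presented_group P\<^esub> (B \<otimes>\<^bsub>presented_group P\<^esub> D)"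
    using u v w by (simp add: presented_group_mult[OF P])
qed

lemma finite_sub_presentation:
  assumes "finite_presentation P" "S \<subseteq> gens P"
  shows "finite_presentation (sub_presentation P S)"
  using assms by (auto simp: finite_presentation_def sub_presentation_def finite_subset)

lemma words_over_mono: "S \<subseteq> X \<Longrightarrow> u \<in> words_over S \<Longrightarrow> u \<in> words_over X"
  unfolding words_over_def by (meson Sigma_mono lists_mono order_refl subsetD)

lemma word_equiv_sub_presentation:
  assumes "word_equiv (sub_presentation P S) u v" "S \<subseteq> gens P"
  shows "word_equiv P u v"
  using assms
proof induction
  case (trans u v w)
  then show ?case by (blast intro: word_equiv.trans)
next
  case (cancel u v l)
  then have "u \<in> words_over (gens P)" "v \<in> words_over (gens P)" "fst l \<in> gens P"
    by (auto simp: sub_presentation_def intro: words_over_mono)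
  then show ?case by (rule word_equiv.cancel)
next
  case (relator u v r)
  then have "u \<in> words_over (gens P)" "v \<in> words_over (gens P)" "r \<in> set (rels P)"
    by (auto simp: sub_presentation_def intro: words_over_mono)
  then show ?case by (rule word_equiv.relator)
qed (auto simp: sub_presentation_def intro: word_equiv.refl word_equiv.sym words_over_mono)

lemma inclusion_map_class:
  assumes P: "finite_presentation P" and S: "S \<subseteq> gens P" and u: "u \<in> words_over S"
  shows "inclusion_map P (word_rel (sub_presentation P S) `` {u}) = word_rel P `` {u}"
proof -
  have "word_equiv (sub_presentation P S) u u"
    using u by (intro word_equiv.refl) (simp add: sub_presentation_def)
  then show ?thesis
    using word_equiv_sub_presentation[OF _ S]
    by (auto simp: inclusion_map_def word_rel_def intro: word_equiv.trans)
qed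

lemma inclusion_map_hom:
  assumes P: "finite_presentation P" and S: "S \<subseteq> gens P"
  shows "inclusion_map P \<in> hom (presented_group (sub_presentation P S)) (presented_group P)"
proof (rule homI)
  have g: "gens (sub_presentation P S) = S" by (simp add: sub_presentation_def)
  fix A assume "A \<in> carrier (presented_group (sub_presentation P S))"
  then obtain u where u: "u \<in> words_over S" "A = word_rel (sub_presentation P S) `` {u}"
    by (rule presented_group_cases) (simp add: g)
  then show "inclusion_map P A \<in> carrier (presented_group P)"
    using words_over_mono[OF S] by (simp add: inclusion_map_class[OF P S] word_class_closed)
  fix B assume "B \<in> carrier (presented_group (sub_presentation P S))"
  then obtain v where v: "v \<in> words_over S" "B = word_rel (sub_presentation P S) `` {v}"
    by (rule presented_group_cases) (simp add: g)
  show "inclusion_map P (A \<otimes>\<^bsub>presented_group (sub_presentation P S)\<^esub> B) =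
      inclusion_map P A \<otimes>\<^bsub>presented_group P\<^esub> inclusion_map P B"
    using u v words_over_mono[OF S]
    by (simp add: presented_group_mult[OF finite_sub_presentation[OF P S]] g
        presented_group_mult[OF P] inclusion_map_class[OF P S])
qed

end

theory Submission
  imports Defs "HOL-Algebra.Coset"
begin

text \<open>
  Why the theorem is true. Let \<open>w\<close> be a word over \<open>S\<close> that is trivial in \<open>G(P)\<close>. By van Kampen's
  lemma \<open>w\<close> is the boundary word of a planar diagram over \<open>P\<close> (\<open>fillable_word_equiv\<close>). Choose
  such a diagram with as few darts as possible, and glue it to its mirror image along the common
  boundary. The double is a spherical diagram, and all edges on the seam have labels in \<open>S\<close>. If an
  edge of the diagram had a label \<open>x\<close> outside \<open>S\<close>, the double would have a folding edge with
  label \<open>x\<close>. That edge does not lie on the seam, so it is a folding edge of the diagram or of its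
  mirror image, and removing the two 2-cells there would give a smaller diagram for \<open>w\<close>. So
  all labels are in \<open>S\<close> (\<open>minimal_filling_labels\<close>), all 2-cells belong to the sub-presentation, and
  the other half of van Kampen's lemma shows that \<open>w\<close> is trivial in \<open>G(P\<^sub>S)\<close>
  (\<open>filling_word_trivial\<close>).

  All of this surgery happens on combinatorial maps, that is, on pairs of permutations \<open>\<alpha>\<close> (the
  two sides of an edge) and \<open>\<phi>\<close> (the next dart on a face). Gluing, cutting and folding may pinch a
  sphere into several, so the class of maps that is used consists of disjoint unions of spheres:
  the number of vertices, edges and faces is compared with twice the number of components. Up to
  adding and dropping components, every surgery is a product of multiplications of \<open>\<alpha>\<close> or \<open>\<phi>\<close>
  by a transposition. Such a step changes the number of cycles of the permutation, of the product \<open>\<phi> \<circ> \<alpha>\<close> and the number of components by at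
  most one each, and the inequality that no surface has negative genus (\<open>euler_le\<close>) then decides
  that the result still consists of spheres. This replaces all arguments about curves in the
  plane; in particular it shows that an edge with the same face on both sides disconnects the map
  (\<open>planar_split_separates\<close>).
\<close>

section \<open>Equivalence closures and the number of their classes\<close>

text \<open>
  The symbol for inverse functions is taken by inverses in groups.
\<close>

abbreviation (input) finv :: "('c \<Rightarrow> 'd) \<Rightarrow> 'd \<Rightarrow> 'c" where
  "finv f \<equiv> inv_into UNIV f"

text \<open>
  The equivalence relation generated by \<open>R\<close>. Applied to the graphs of permutations it expresses
  that two darts lie on the same face, edge or vertex, or in the same component.
\<close>

definition equiv_cl :: "('d \<times> 'd) set \<Rightarrow> ('d \<times> 'd) set" where
  "equiv_cl R = (R \<union> R\<inverse>)\<^sup>*"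

definition graph_of :: "('d \<Rightarrow> 'd) \<Rightarrow> ('d \<times> 'd) set" where
  "graph_of p = range (\<lambda>x. (x, p x))"

definition num_classes :: "'d set \<Rightarrow> ('d \<times> 'd) set \<Rightarrow> nat" where
  "num_classes D R = card ((\<lambda>x. equiv_cl R `` {x}) ` D)"

lemma equiv_cl_refl [simp, intro]: "(x, x) \<in> equiv_cl R"
  by (simp add: equiv_cl_def)

lemma equiv_cl_sym: "(x, y) \<in> equiv_cl R \<Longrightarrow> (y, x) \<in> equiv_cl R"
  unfolding equiv_cl_def by (metis converse_Un converse_converse rtrancl_converseI sup_commute)

lemma equiv_cl_trans: "(x, y) \<in> equiv_cl R \<Longrightarrow> (y, z) \<in> equiv_cl R \<Longrightarrow> (x, z) \<in> equiv_cl R"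
  unfolding equiv_cl_def by (rule rtrancl_trans)

lemma equiv_cl_base: "(x, y) \<in> R \<Longrightarrow> (x, y) \<in> equiv_cl R"
  unfolding equiv_cl_def by blast

text \<open>
  The way in which relations are refuted below: a function that is constant along \<open>R\<close> separates
  its classes.
\<close>

lemma equiv_cl_invariant:
  assumes "(x, y) \<in> equiv_cl R" and "\<And>u v. (u, v) \<in> R \<Longrightarrow> f u = f v"
  shows "f x = f y"
  using assms(1) unfolding equiv_cl_def
  by (induction rule: rtrancl_induct) (use assms(2) in auto)

lemma equiv_cl_class_eq_iff: "equiv_cl R `` {x} = equiv_cl R `` {y} \<longleftrightarrow> (x, y) \<in> equiv_cl R"
  by (auto intro: equiv_cl_sym equiv_cl_trans)

lemma equiv_cl_subset:
  assumes "R \<subseteq> equiv_cl S"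
  shows "equiv_cl R \<subseteq> equiv_cl S"
proof
  fix p assume "p \<in> equiv_cl R"
  moreover obtain x y where p: "p = (x, y)" by fastforce
  ultimately have "equiv_cl S `` {x} = equiv_cl S `` {y}"
    using assms by (intro equiv_cl_invariant[of x y R "\<lambda>x. equiv_cl S `` {x}"]) (auto simp: equiv_cl_class_eq_iff)
  then show "p \<in> equiv_cl S" by (simp add: p equiv_cl_class_eq_iff)
qed

lemma equiv_cl_eqI: "R \<subseteq> equiv_cl S \<Longrightarrow> S \<subseteq> equiv_cl R \<Longrightarrow> equiv_cl R = equiv_cl S"
  by (meson equiv_cl_subset subset_antisym)

lemma equiv_cl_mono: "R \<subseteq> S \<Longrightarrow> equiv_cl R \<subseteq> equiv_cl S"
  by (rule equiv_cl_subset) (auto intro: equiv_cl_base)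

lemma equiv_cl_graph_step:
  "(x, p x) \<in> equiv_cl (graph_of p \<union> R)" "(x, p x) \<in> equiv_cl (graph_of p)" "(x, p x) \<in> equiv_cl (R \<union> graph_of p)"
  by (auto simp: graph_of_def intro!: equiv_cl_base)

lemma graph_of_iff [simp]: "(x, y) \<in> graph_of p \<longleftrightarrow> y = p x"
  by (auto simp: graph_of_def)

lemma equiv_cl_insert_absorb: "(a, b) \<in> equiv_cl R \<Longrightarrow> equiv_cl (insert (a, b) R) = equiv_cl R"
  by (rule equiv_cl_eqI) (auto intro: equiv_cl_base)

lemma equiv_cl_insert_iff:
  "(x, y) \<in> equiv_cl (insert (a, b) R) \<longleftrightarrow>
    (x, y) \<in> equiv_cl R \<or> (x, a) \<in> equiv_cl R \<and> (b, y) \<in> equiv_cl R \<or> (x, b) \<in> equiv_cl R \<and> (a, y) \<in> equiv_cl R"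
    (is "?L \<longleftrightarrow> ?M x y")
proof
  assume ?L
  then have "?M x x = ?M x y"
  proof (rule equiv_cl_invariant)
    fix u v assume "(u, v) \<in> insert (a, b) R"
    then have "(u, v) = (a, b) \<or> (u, v) \<in> equiv_cl R" by (auto intro: equiv_cl_base)
    then show "?M x u = ?M x v"
    proof
      assume "(u, v) = (a, b)"
      then show ?thesis by auto
    next
      assume uv: "(u, v) \<in> equiv_cl R"
      have "(y, u) \<in> equiv_cl R \<longleftrightarrow> (y, v) \<in> equiv_cl R" for y
        using equiv_cl_trans[OF _ uv] equiv_cl_trans[OF _ equiv_cl_sym[OF uv]] by blast
      then show ?thesis by simp
    qed
  qed
  then show "?M x y" by simp
next
  have "equiv_cl R \<subseteq> equiv_cl (insert (a, b) R)" by (rule equiv_cl_mono) auto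
  moreover have "(a, b) \<in> equiv_cl (insert (a, b) R)" "(b, a) \<in> equiv_cl (insert (a, b) R)"
    by (auto intro: equiv_cl_base equiv_cl_sym)
  moreover assume "?M x y"
  ultimately show ?L by (meson equiv_cl_trans subsetD)
qed

lemma num_classes_insert:
  assumes "finite D" "a \<in> D" "b \<in> D" "(a, b) \<notin> equiv_cl R"
  shows "num_classes D R = Suc (num_classes D (insert (a, b) R))"
proof -
  let ?c = "\<lambda>x. equiv_cl R `` {x}" and ?c' = "\<lambda>x. equiv_cl (insert (a, b) R) `` {x}"
  define D0 where "D0 = {x \<in> D. (x, a) \<notin> equiv_cl R \<and> (x, b) \<notin> equiv_cl R}"
  have c': "?c' x = (if (x, a) \<in> equiv_cl R \<or> (x, b) \<in> equiv_cl R then ?c a \<union> ?c b else ?c x)" for x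
  proof -
    have "?c x = ?c a" if "(x, a) \<in> equiv_cl R" using that by (simp add: equiv_cl_class_eq_iff)
    moreover have "?c x = ?c b" if "(x, b) \<in> equiv_cl R" using that by (simp add: equiv_cl_class_eq_iff)
    moreover have "?c' x = ?c x \<union> (if (x, a) \<in> equiv_cl R then ?c b else {}) \<union>
        (if (x, b) \<in> equiv_cl R then ?c a else {})"
      by (auto simp: equiv_cl_insert_iff)
    ultimately show ?thesis by auto
  qed
  have "?c' ` D = insert (?c a \<union> ?c b) (?c ` D0)"
    using assms(2) by (auto simp: c' D0_def image_iff)
  moreover have "?c ` D = insert (?c a) (insert (?c b) (?c ` D0))"
  proof (intro equalityI subsetI)
    fix y assume "y \<in> ?c ` D"
    then obtain x where x: "x \<in> D" "y = ?c x" by blast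
    show "y \<in> insert (?c a) (insert (?c b) (?c ` D0))"
    proof (cases "x \<in> D0")
      case False
      then have "?c x = ?c a \<or> ?c x = ?c b" using x by (auto simp: D0_def equiv_cl_class_eq_iff)
      then show ?thesis using x(2) by auto
    qed (use x in simp)
  next
    fix y assume "y \<in> insert (?c a) (insert (?c b) (?c ` D0))"
    then show "y \<in> ?c ` D" using assms(2,3) by (auto simp: D0_def simp del: Image_singleton_iff)
  qed
  moreover have "?c a \<noteq> ?c b" using assms(4) by (simp add: equiv_cl_class_eq_iff)
  moreover have "?c a \<notin> ?c ` D0" "?c b \<notin> ?c ` D0" "?c a \<union> ?c b \<notin> ?c ` D0"
    by (auto simp: D0_def equiv_cl_class_eq_iff intro: equiv_cl_sym)
  moreover have "finite (?c ` D0)" using assms(1) by (simp add: D0_def)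
  ultimately show ?thesis by (simp add: num_classes_def)
qed

lemma num_classes_cong: "(\<And>x. x \<in> D \<Longrightarrow> equiv_cl R `` {x} = equiv_cl S `` {x}) \<Longrightarrow> num_classes D R = num_classes D S"
  unfolding num_classes_def by (metis (no_types, lifting) image_cong)

lemma num_classes_Un:
  assumes "finite D" "K \<subseteq> D" "\<And>u v. (u, v) \<in> R \<Longrightarrow> u \<in> K \<longleftrightarrow> v \<in> K"
  shows "num_classes D R = num_classes K R + num_classes (D - K) R"
proof -
  let ?c = "\<lambda>x. equiv_cl R `` {x}"
  have "?c ` K \<inter> ?c ` (D - K) = {}"
    using equiv_cl_invariant[of _ _ R "\<lambda>x. x \<in> K"] assms(3) by (fastforce simp: equiv_cl_class_eq_iff)
  moreover have "?c ` D = ?c ` K \<union> ?c ` (D - K)" using assms(2) by auto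
  moreover have "finite K" using assms by (auto intro: finite_subset)
  ultimately show ?thesis
    using assms(1) by (simp add: num_classes_def card_Un_disjoint)
qed

lemma equiv_cl_map:
  assumes "bij f"
  shows "(f x, f y) \<in> equiv_cl (map_prod f f ` R) \<longleftrightarrow> (x, y) \<in> equiv_cl R"
proof
  assume "(f x, f y) \<in> equiv_cl (map_prod f f ` R)"
  then have "equiv_cl R `` {finv f (f x)} = equiv_cl R `` {finv f (f y)}"
    using assms by (rule_tac equiv_cl_invariant) (auto simp: bij_is_inj equiv_cl_class_eq_iff intro: equiv_cl_base)
  then show "(x, y) \<in> equiv_cl R" using assms by (simp add: bij_is_inj equiv_cl_class_eq_iff)
next
  assume "(x, y) \<in> equiv_cl R"
  then have "equiv_cl (map_prod f f ` R) `` {f x} = equiv_cl (map_prod f f ` R) `` {f y}"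
    by (rule equiv_cl_invariant) (force simp: equiv_cl_class_eq_iff intro: equiv_cl_base)
  then show "(f x, f y) \<in> equiv_cl (map_prod f f ` R)" by (simp add: equiv_cl_class_eq_iff)
qed

text \<open>
  Renaming the points. With \<open>f\<close> a permutation of \<open>D\<close> this says that conjugation preserves the
  number of cycles.
\<close>

lemma num_classes_map:
  assumes "bij f"
  shows "num_classes (f ` D) (map_prod f f ` R) = num_classes D R"
proof -
  have "equiv_cl (map_prod f f ` R) `` {f x} = f ` (equiv_cl R `` {x})" for x
  proof (intro Set.set_eqI)
    fix y
    obtain z where "y = f z" using assms by (metis bij_pointE)
    then show "y \<in> equiv_cl (map_prod f f ` R) `` {f x} \<longleftrightarrow> y \<in> f ` (equiv_cl R `` {x})"
      using assms by (auto simp: equiv_cl_map bij_is_inj inj_image_mem_iff)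
  qed
  then have "(\<lambda>x. equiv_cl (map_prod f f ` R) `` {x}) ` f ` D = (`) f ` (\<lambda>x. equiv_cl R `` {x}) ` D"
    by (simp add: image_image)
  moreover have "inj ((`) f)" 
    using assms by (intro injI) (simp add: bij_is_inj inj_image_eq_iff)
  ultimately show ?thesis
    unfolding num_classes_def by (metis card_image inj_on_subset subset_UNIV)
qed

section \<open>Cycles of permutations and transpositions\<close>

lemma equiv_cl_graph_inverse:
  assumes "bij p" shows "equiv_cl (graph_of (finv p)) = equiv_cl (graph_of p)"
proof -
  have "graph_of (finv p) = (graph_of p)\<inverse>"
    using assms
    by (auto simp: graph_of_def bij_is_inj bij_is_surj surj_f_inv_f image_iff)
  then show ?thesis by (simp add: equiv_cl_def Un_commute)
qed

lemma equiv_cl_graph_orbit: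
  assumes "finite D" "p permutes D"
  shows "equiv_cl (graph_of p) `` {x} = orbit p x"
proof
  have perm: "permutation p" using assms permutation_permutes by blast
  show "orbit p x \<subseteq> equiv_cl (graph_of p) `` {x}"
  proof
    fix y assume "y \<in> orbit p x"
    then show "y \<in> equiv_cl (graph_of p) `` {x}"
      by induction (auto intro: equiv_cl_trans equiv_cl_graph_step)
  qed
  show "equiv_cl (graph_of p) `` {x} \<subseteq> orbit p x"
  proof
    fix y assume "y \<in> equiv_cl (graph_of p) `` {x}"
    then have "(x, y) \<in> equiv_cl (graph_of p)" by simp
    then have "orbit p x = orbit p y"
      by (rule equiv_cl_invariant) (auto simp: graph_of_def permutation_orbit_step[OF perm])
    then show "y \<in> orbit p x" using permutation_self_in_orbit[OF perm] by simp
  qed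
qed

lemma num_classes_orbits:
  assumes "finite D" "p permutes D"
  shows "num_classes D (graph_of p) = card (orbit p ` D)"
  by (simp add: num_classes_def equiv_cl_graph_orbit[OF assms])

text \<open>
  Once \<open>a\<close> and \<open>b\<close> are identified it makes no difference which of them is sent to \<open>p a\<close> and which
  to \<open>p b\<close>. So the effect of a transposition on the number of classes only depends on whether \<open>a\<close>
  and \<open>b\<close> are related before and after.
\<close>

lemma equiv_cl_insert_transpose:
  "equiv_cl (insert (a, b) (graph_of (p \<circ> transpose a b) \<union> S)) = equiv_cl (insert (a, b) (graph_of p \<union> S))"
proof -
  have sub: "equiv_cl (insert (a, b) (graph_of (p \<circ> transpose a b) \<union> S)) \<subseteq>
      equiv_cl (insert (a, b) (graph_of p \<union> S))" for p :: "'a \<Rightarrow> 'a"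
  proof (rule equiv_cl_subset)
    let ?E = "equiv_cl (insert (a, b) (graph_of p \<union> S))"
    have ab: "(a, b) \<in> ?E" "(b, a) \<in> ?E" by (auto intro: equiv_cl_base equiv_cl_sym)
    have p: "(x, p x) \<in> ?E" for x by (auto simp: graph_of_def intro!: equiv_cl_base)
    have "(x, p (transpose a b x)) \<in> ?E" for x
      using ab p[of x] equiv_cl_trans[OF ab(1) p] equiv_cl_trans[OF ab(2) p] by (simp add: transpose_def)
    then show "insert (a, b) (graph_of (p \<circ> transpose a b) \<union> S) \<subseteq> ?E"
      using ab by (auto simp: graph_of_def intro: equiv_cl_base)
  qed
  have "p \<circ> transpose a b \<circ> transpose a b = p" by (simp add: fun_eq_iff)
  then show ?thesis using sub[of p] sub[of "p \<circ> transpose a b"] by auto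
qed

text \<open>
  Follow the cycle of \<open>p\<close> from \<open>p b\<close> until it first reaches \<open>a\<close>. The points met on the way do not
  include \<open>b\<close>, and \<open>p \<circ> transpose a b\<close> permutes them, because it sends \<open>a\<close> back to \<open>p b\<close>.
\<close>

lemma transpose_separates:
  assumes "finite D" "p permutes D" "a \<noteq> b" "(a, b) \<in> equiv_cl (graph_of p)"
  shows "(a, b) \<notin> equiv_cl (graph_of (p \<circ> transpose a b))"
proof -
  let ?q = "p \<circ> transpose a b"
  have "a \<in> orbit p b"
    using assms equiv_cl_graph_orbit[OF assms(1,2), of b] equiv_cl_sym by fastforce
  then obtain n where n: "0 < n" "(p ^^ n) b = a" by (auto simp: orbit_altdef)
  define m where "m = (LEAST n. 0 < n \<and> (p ^^ n) b = a)"
  have m: "0 < m" "(p ^^ m) b = a"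
    using LeastI[of "\<lambda>n. 0 < n \<and> (p ^^ n) b = a" n] n by (auto simp: m_def)
  have least: "(p ^^ k) b \<noteq> a" if "0 < k" "k < m" for k
    using not_less_Least[of k "\<lambda>n. 0 < n \<and> (p ^^ n) b = a"] that by (auto simp: m_def)
  define A where "A = (\<lambda>k. (p ^^ k) b) ` {1..m}"
  have bA: "b \<notin> A"
  proof
    assume "b \<in> A"
    then obtain k where k: "1 \<le> k" "k \<le> m" "(p ^^ k) b = b" by (auto simp: A_def)
    with m assms(3) have "k < m" by (cases "k = m") auto
    then have "(p ^^ (m - k)) ((p ^^ k) b) = a"
      using m(2) by (metis funpow_add le_add_diff_inverse2 less_imp_le o_apply)
    then show False using least[of "m - k"] k \<open>k < m\<close> by simp
  qed
  have step: "?q x \<in> A" if xA: "x \<in> A" for x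
  proof -
    obtain k where k: "1 \<le> k" "k \<le> m" "x = (p ^^ k) b" using xA by (auto simp: A_def)
    show ?thesis
    proof (cases "k = m")
      case True
      then have "?q x = (p ^^ 1) b" using k m by simp
      moreover have "(p ^^ 1) b \<in> A" unfolding A_def using m(1) by (intro imageI) simp
      ultimately show ?thesis by simp
    next
      case False
      then have "x \<noteq> a" "x \<noteq> b" using least[of k] k bA xA by auto
      then have "?q x = (p ^^ Suc k) b" using k by simp
      moreover have "(p ^^ Suc k) b \<in> A" unfolding A_def using k False by (intro imageI) simp
      ultimately show ?thesis by simp
    qed
  qed
  have inj: "inj ?q"
    using assms(2) by (intro inj_compose) (auto simp: permutes_inj)
  have "?q ` A = A"
  proof (rule endo_inj_surj)
    show "finite A" by (simp add: A_def)
    show "?q ` A \<subseteq> A" using step by blast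
    show "inj_on ?q A" using inj by (rule inj_on_subset) simp
  qed
  then have "x \<in> A \<longleftrightarrow> ?q x \<in> A" for x
    using inj by (metis inj_image_mem_iff)
  then have "(a \<in> A) = (b \<in> A)" if "(a, b) \<in> equiv_cl (graph_of ?q)"
    using that by (intro equiv_cl_invariant[of a b _ "\<lambda>x. x \<in> A"]) (auto simp: graph_of_def)
  moreover have "a \<in> A" using m unfolding A_def by force
  ultimately show ?thesis using bA by blast
qed

text \<open>
  The cycle of \<open>p\<close> through \<open>a\<close> does not meet \<open>b\<close>, so from \<open>p a\<close> up to \<open>a\<close> it is also followed by
  \<open>p \<circ> transpose a b\<close>, which sends \<open>b\<close> to \<open>p a\<close>.
\<close>

lemma transpose_joins:
  assumes "finite D" "p permutes D" "(a, b) \<notin> equiv_cl (graph_of p)"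
  shows "(a, b) \<in> equiv_cl (graph_of (p \<circ> transpose a b))"
proof -
  let ?q = "p \<circ> transpose a b"
  have perm: "permutation p" using assms permutation_permutes by blast
  have ab: "a \<noteq> b" using assms(3) by auto
  have "a \<in> orbit p a" by (rule permutation_self_in_orbit[OF perm])
  then obtain n where n: "0 < n" "(p ^^ n) a = a" by (auto simp: orbit_altdef)
  define m where "m = (LEAST n. 0 < n \<and> (p ^^ n) a = a)"
  have m: "0 < m" "(p ^^ m) a = a"
    using LeastI[of "\<lambda>n. 0 < n \<and> (p ^^ n) a = a" n] n by (auto simp: m_def)
  have least: "(p ^^ k) a \<noteq> a" if "0 < k" "k < m" for k
    using not_less_Least[of k "\<lambda>n. 0 < n \<and> (p ^^ n) a = a"] that by (auto simp: m_def)
  have nb: "(p ^^ k) a \<noteq> b" for k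
  proof (cases k)
    case (Suc j)
    then have "0 < k" by simp
    then have "(p ^^ k) a \<in> orbit p a" unfolding orbit_altdef by blast
    then show ?thesis using assms(3) equiv_cl_graph_orbit[OF assms(1,2), of a] by blast
  qed (use ab in simp)
  have "(b, (p ^^ Suc k) a) \<in> equiv_cl (graph_of ?q)" if "k < m" for k
    using that
  proof (induction k)
    case 0
    then show ?case using equiv_cl_graph_step(2)[of b ?q] by (simp add: comp_def)
  next
    case (Suc k)
    then have "?q ((p ^^ Suc k) a) = (p ^^ Suc (Suc k)) a"
      using least[of "Suc k"] nb[of "Suc k"] by simp
    then have "((p ^^ Suc k) a, (p ^^ Suc (Suc k)) a) \<in> equiv_cl (graph_of ?q)"
      using equiv_cl_graph_step(2)[of "(p ^^ Suc k) a" ?q] by (metis (no_types))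
    then show ?case using Suc by (meson Suc_lessD equiv_cl_trans)
  qed
  from this[of "m - 1"] m show ?thesis by (auto intro: equiv_cl_sym)
qed

lemma permutes_comp_transpose:
  "p permutes D \<Longrightarrow> a \<in> D \<Longrightarrow> b \<in> D \<Longrightarrow> p \<circ> transpose a b permutes D"
  by (intro permutes_compose permutes_swap_id)

lemma num_classes_transpose_split:
  assumes "finite D" "p permutes D" "a \<in> D" "b \<in> D" "a \<noteq> b" "(a, b) \<in> equiv_cl (graph_of p)"
  shows "num_classes D (graph_of (p \<circ> transpose a b)) = Suc (num_classes D (graph_of p))"
  using num_classes_insert[OF assms(1,3,4) transpose_separates[OF assms(1,2,5,6)]]
    equiv_cl_insert_transpose[of a b p "{}"] equiv_cl_insert_absorb[OF assms(6)]
  by (simp add: num_classes_def)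

lemma num_classes_transpose_join:
  assumes "finite D" "p permutes D" "a \<in> D" "b \<in> D" "(a, b) \<notin> equiv_cl (graph_of p)"
  shows "num_classes D (graph_of p) = Suc (num_classes D (graph_of (p \<circ> transpose a b)))"
  using num_classes_insert[OF assms(1,3,4,5)]
    equiv_cl_insert_transpose[of a b p "{}"] equiv_cl_insert_absorb[OF transpose_joins[OF assms(1,2,5)]]
  by (simp add: num_classes_def)

section \<open>The Euler characteristic of a pair of permutations\<close>

text \<open>
  For a map with edges \<open>p\<close> and faces \<open>q\<close> the cycles of \<open>q \<circ> p\<close> are the vertices. If \<open>p\<close> is
  an involution with \<open>E\<close> cycles and without fixed points, there are \<open>2 * E\<close> darts, and
  \<open>euler D p q = card D\<close> says that \<open>V - E + F\<close> is twice the number of components. The formula makes sense for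
  arbitrary permutations \<open>p\<close> and \<open>q\<close> (hypermaps), which are needed as intermediate steps of a surgery.
\<close>

definition euler :: "'d set \<Rightarrow> ('d \<Rightarrow> 'd) \<Rightarrow> ('d \<Rightarrow> 'd) \<Rightarrow> int" where
  "euler D p q = int (num_classes D (graph_of p)) + int (num_classes D (graph_of q))
    + int (num_classes D (graph_of (q \<circ> p))) - 2 * int (num_classes D (graph_of p \<union> graph_of q))"

definition planar :: "'d set \<Rightarrow> ('d \<Rightarrow> 'd) \<Rightarrow> ('d \<Rightarrow> 'd) \<Rightarrow> bool" where
  "planar D p q \<longleftrightarrow> euler D p q = int (card D)"

lemma equiv_cl_superset: "R \<subseteq> equiv_cl R"
  by (auto intro: equiv_cl_base)

lemma graph_subset_connected: "equiv_cl (graph_of p) \<subseteq> equiv_cl (graph_of p \<union> R)"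
  by (rule equiv_cl_mono) auto

lemma graph_comp_connected: "equiv_cl (graph_of (q \<circ> p)) \<subseteq> equiv_cl (graph_of p \<union> graph_of q)"
proof (rule equiv_cl_subset)
  have "(x, q (p x)) \<in> equiv_cl (graph_of p \<union> graph_of q)" for x
    using equiv_cl_trans[OF equiv_cl_graph_step(1)[of x p "graph_of q"] equiv_cl_graph_step(3)[of "p x" q "graph_of p"]]
    by simp
  then show "graph_of (q \<circ> p) \<subseteq> equiv_cl (graph_of p \<union> graph_of q)" by (auto simp: graph_of_def)
qed

text \<open>
  The effect of multiplying \<open>p\<close> by the transposition of \<open>a\<close> and \<open>b\<close>. The cycles of \<open>p\<close> and of
  \<open>q \<circ> p\<close> change by one in the direction determined by whether \<open>a\<close> and \<open>b\<close> lie on the same cycle,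
  and the number of components changes if \<open>a\<close> and \<open>b\<close> get connected or disconnected.
\<close>

context
  fixes D :: "'d set" and p q :: "'d \<Rightarrow> 'd" and a b :: 'd
  assumes D: "finite D" and p: "p permutes D" and q: "q permutes D"
    and a: "a \<in> D" and b: "b \<in> D" and ab: "a \<noteq> b"
begin

private abbreviation (input) "p' \<equiv> p \<circ> transpose a b"

lemma qp_permutes: "q \<circ> p permutes D"
  using p q by (rule permutes_compose)

lemma num_classes_transpose:
  "int (num_classes D (graph_of p')) = int (num_classes D (graph_of p)) +
    (if (a, b) \<in> equiv_cl (graph_of p) then 1 else - 1)"
  "int (num_classes D (graph_of (q \<circ> p'))) = int (num_classes D (graph_of (q \<circ> p))) +
    (if (a, b) \<in> equiv_cl (graph_of (q \<circ> p)) then 1 else - 1)"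
  using num_classes_transpose_split[OF D p a b ab] num_classes_transpose_join[OF D p a b]
    num_classes_transpose_split[OF D qp_permutes a b ab] num_classes_transpose_join[OF D qp_permutes a b]
  by (auto simp flip: comp_assoc)

lemma num_components_transpose:
  "int (num_classes D (graph_of p' \<union> graph_of q)) = int (num_classes D (graph_of p \<union> graph_of q)) +
    (if (a, b) \<in> equiv_cl (graph_of p' \<union> graph_of q) then 0 else 1) -
    (if (a, b) \<in> equiv_cl (graph_of p \<union> graph_of q) then 0 else 1)"
proof -
  have key: "int (num_classes D R) = int (num_classes D (insert (a, b) R)) +
      (if (a, b) \<in> equiv_cl R then 0 else 1)" for R
    using num_classes_insert[OF D a b, of R] equiv_cl_insert_absorb[of a b R]
    by (auto simp: num_classes_def)
  have "num_classes D (insert (a, b) (graph_of p' \<union> graph_of q)) =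
      num_classes D (insert (a, b) (graph_of p \<union> graph_of q))"
    by (simp add: num_classes_def equiv_cl_insert_transpose)
  then show ?thesis
    using key[of "graph_of p' \<union> graph_of q"] key[of "graph_of p \<union> graph_of q"] by simp
qed

lemma qp_split_connected:
  "(a, b) \<notin> equiv_cl (graph_of (q \<circ> p)) \<Longrightarrow> (a, b) \<in> equiv_cl (graph_of p' \<union> graph_of q)"
  using transpose_joins[OF D qp_permutes] graph_comp_connected[of q p']
  by (auto simp flip: comp_assoc)

text \<open>
  \<open>p\<close> gains a cycle. If \<open>q \<circ> p\<close> loses one, \<open>a\<close> and \<open>b\<close> stay connected and nothing changes; if \<open>q \<circ> p\<close>
  gains one, the sum grows by two, which at most one additional component takes away.
\<close>

lemma euler_split:
  assumes "(a, b) \<in> equiv_cl (graph_of p)"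
  shows "euler D p q \<le> euler D p' q"
proof -
  have "(a, b) \<in> equiv_cl (graph_of p \<union> graph_of q)"
    using assms graph_subset_connected by blast
  then show ?thesis
    using assms num_classes_transpose num_components_transpose qp_split_connected
    by (auto simp: euler_def)
qed

text \<open>
  The cycle lost by \<open>p\<close> is gained by \<open>q \<circ> p\<close>, and the components stay the same.
\<close>

lemma euler_free_join:
  assumes "(a, b) \<notin> equiv_cl (graph_of p)" "(a, b) \<in> equiv_cl (graph_of (q \<circ> p))"
  shows "euler D p q = euler D p' q"
proof -
  have "(a, b) \<in> equiv_cl (graph_of p \<union> graph_of q)"
    using assms(2) graph_comp_connected by blast
  moreover have "(a, b) \<in> equiv_cl (graph_of p' \<union> graph_of q)"
    using transpose_joins[OF D p assms(1)] graph_subset_connected by blast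
  ultimately show ?thesis
    using assms num_classes_transpose num_components_transpose by (auto simp: euler_def)
qed

text \<open>
  Both \<open>p\<close> and \<open>q \<circ> p\<close> lose a cycle, and one component is lost.
\<close>

lemma euler_join:
  assumes "(a, b) \<notin> equiv_cl (graph_of p \<union> graph_of q)"
  shows "euler D p q = euler D p' q"
proof -
  have np: "(a, b) \<notin> equiv_cl (graph_of p)" using assms graph_subset_connected by blast
  moreover have "(a, b) \<notin> equiv_cl (graph_of (q \<circ> p))" using assms graph_comp_connected by blast
  moreover have "(a, b) \<in> equiv_cl (graph_of p' \<union> graph_of q)"
    using transpose_joins[OF D p np] graph_subset_connected by blast
  ultimately show ?thesis
    using assms num_classes_transpose num_components_transpose by (auto simp: euler_def)
qed

lemma euler_nonseparating:
  assumes "(a, b) \<in> equiv_cl (graph_of p)" "(a, b) \<in> equiv_cl (graph_of (q \<circ> p))"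
    and "(a, b) \<in> equiv_cl (graph_of p' \<union> graph_of q)"
  shows "euler D p' q = euler D p q + 2"
proof -
  have "(a, b) \<in> equiv_cl (graph_of p \<union> graph_of q)"
    using assms graph_subset_connected by blast
  then show ?thesis
    using assms num_classes_transpose num_components_transpose by (auto simp: euler_def)
qed

end

lemma num_classes_id: "num_classes D (graph_of id) = card D"
proof -
  have "(\<lambda>x. equiv_cl (graph_of id) `` {x}) = (\<lambda>x. {x :: 'a})"
  proof
    fix x :: 'a
    have "y = x" if "(x, y) \<in> equiv_cl (graph_of id)" for y
      using equiv_cl_invariant[OF that, of "\<lambda>x. x"] by simp
    then show "equiv_cl (graph_of id) `` {x} = {x}" by auto
  qed
  then show ?thesis by (simp add: num_classes_def card_image)
qed

lemma euler_id: "euler D id q = int (card D)"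
proof -
  have "equiv_cl (graph_of id \<union> graph_of q) = equiv_cl (graph_of q)"
    by (rule equiv_cl_eqI) (auto simp: graph_of_def intro: equiv_cl_base)
  then have "num_classes D (graph_of id \<union> graph_of q) = num_classes D (graph_of q)"
    by (simp add: num_classes_def)
  then show ?thesis by (simp add: euler_def num_classes_id)
qed

text \<open>
  The genus is not negative. Multiplying \<open>p\<close> by the transposition of \<open>a\<close> and \<open>p a\<close> turns \<open>p a\<close> into
  a fixed point and does not decrease \<open>euler D p q\<close> by \<open>euler_split\<close>. After finitely many such steps
  \<open>p\<close> is the identity, where equality holds.
\<close>

lemma euler_le:
  assumes "finite D" "p permutes D" "q permutes D"
  shows "euler D p q \<le> int (card D)"
  using assms(2)
proof (induction "card {x \<in> D. p x \<noteq> x}" arbitrary: p rule: less_induct)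
  case less
  show ?case
  proof (cases "p = id")
    case True
    then show ?thesis by (simp add: euler_id)
  next
    case False
    then obtain a where ne: "p a \<noteq> a" by (auto simp: fun_eq_iff)
    define b where "b = p a"
    have a: "a \<in> D" using ne less.prems by (meson permutes_not_in)
    then have b: "b \<in> D" using less.prems by (simp add: b_def permutes_in_image)
    have pb: "p b \<noteq> b" using ne permutes_inj[OF less.prems] by (auto simp: b_def dest: injD)
    let ?q = "p \<circ> transpose a b"
    have "{x \<in> D. ?q x \<noteq> x} \<subseteq> {x \<in> D. p x \<noteq> x} - {b}"
    proof
      fix x assume x: "x \<in> {x \<in> D. ?q x \<noteq> x}"
      consider "x = a" | "x = b" | "x \<noteq> a" "x \<noteq> b" by blast
      then show "x \<in> {x \<in> D. p x \<noteq> x} - {b}"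
        using x ne by cases (auto simp: b_def)
    qed
    then have "card {x \<in> D. ?q x \<noteq> x} \<le> card ({x \<in> D. p x \<noteq> x} - {b})"
      using assms(1) by (intro card_mono) auto
    also have "\<dots> < card {x \<in> D. p x \<noteq> x}"
      using pb b assms(1) by (intro psubset_card_mono) auto
    finally have "euler D ?q q \<le> int (card D)"
      using permutes_comp_transpose[OF less.prems a b] by (rule less.hyps)
    moreover have "euler D p q \<le> euler D ?q q"
    proof (rule euler_split[OF assms(1) less.prems assms(3) a b])
      show "a \<noteq> b" using ne by (simp add: b_def)
      show "(a, b) \<in> equiv_cl (graph_of p)" by (simp add: b_def equiv_cl_graph_step)
    qed
    ultimately show ?thesis by simp
  qed
qed

lemma graph_of_conj:
  assumes "bij f" shows "graph_of (f \<circ> p \<circ> finv f) = map_prod f f ` graph_of p"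
proof -
  have "(x, f (p (finv f x))) \<in> map_prod f f ` graph_of p" for x
  proof
    show "(x, f (p (finv f x))) = map_prod f f (finv f x, p (finv f x))"
      using assms by (simp add: bij_is_surj surj_f_inv_f)
  qed (simp add: graph_of_def)
  moreover have "(f x, f (p x)) \<in> graph_of (f \<circ> p \<circ> finv f)" for x
    using assms by (auto simp: graph_of_def image_iff bij_is_inj intro!: exI[of _ "f x"])
  ultimately show ?thesis by (auto simp: graph_of_def)
qed

lemma euler_conj:
  assumes "bij f"
  shows "euler (f ` D) (f \<circ> p \<circ> finv f) (f \<circ> q \<circ> finv f) = euler D p q"
proof -
  have "(f \<circ> q \<circ> finv f) \<circ> (f \<circ> p \<circ> finv f) = f \<circ> (q \<circ> p) \<circ> finv f"
    using assms by (simp add: fun_eq_iff bij_is_inj)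
  then show ?thesis
    unfolding euler_def
    by (simp only: graph_of_conj[OF assms] num_classes_map[OF assms] flip: image_Un)
qed

lemma planar_conj:
  assumes "bij f"
  shows "planar (f ` D) (f \<circ> p \<circ> finv f) (f \<circ> q \<circ> finv f) \<longleftrightarrow> planar D p q"
proof -
  have "card (f ` D) = card D"
    using bij_is_inj[OF assms] by (meson card_image inj_on_subset subset_UNIV)
  then show ?thesis by (simp add: planar_def euler_conj[OF assms])
qed

text \<open>
  \<open>p \<circ> q\<close> is the conjugate of \<open>q \<circ> p\<close> by \<open>p\<close>.
\<close>

lemma num_classes_comp_commute:
  assumes "p permutes D"
  shows "num_classes D (graph_of (p \<circ> q)) = num_classes D (graph_of (q \<circ> p))"
proof -
  have p: "bij p" "p ` D = D" using assms by (auto simp: permutes_bij permutes_image)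
  have "p \<circ> (q \<circ> p) \<circ> finv p = p \<circ> q"
    using p(1) by (simp add: fun_eq_iff bij_is_surj surj_f_inv_f)
  then show ?thesis
    using num_classes_map[OF p(1), of D "graph_of (q \<circ> p)"] p(2)
    by (simp add: graph_of_conj[OF p(1), symmetric])
qed

text \<open>
  By this symmetry the transposition lemmas, which change the first permutation, can be applied both
  to edges and to faces.
\<close>

lemma planar_commute:
  assumes "p permutes D"
  shows "planar D p q \<longleftrightarrow> planar D q p"
  using num_classes_comp_commute[OF assms, of q] by (simp add: planar_def euler_def Un_commute add_ac)

text \<open>
  Reversing the orientation of the surface: \<open>p\<close> is an involution, so \<open>inv q \<circ> p\<close> is the inverse
  of \<open>p \<circ> q\<close>.
\<close>

lemma planar_inverse:
  assumes "p permutes D" "q permutes D" "p \<circ> p = id"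
  shows "planar D p (finv q) \<longleftrightarrow> planar D p q"
proof -
  have bij: "bij p" "bij q" using assms permutes_bij by auto
  have inv_eq: "finv p = p" using assms(3) by (metis inv_unique_comp)
  have q: "equiv_cl (graph_of (finv q)) = equiv_cl (graph_of q)" by (rule equiv_cl_graph_inverse[OF bij(2)])
  have "num_classes D (graph_of (finv q \<circ> p)) = num_classes D (graph_of (p \<circ> q))"
    using equiv_cl_graph_inverse[OF bij_comp[OF bij(2,1)]] o_inv_distrib[OF bij]
    by (simp add: num_classes_def inv_eq)
  then have comp: "num_classes D (graph_of (finv q \<circ> p)) = num_classes D (graph_of (q \<circ> p))"
    using num_classes_comp_commute[OF assms(1)] by simp
  have "equiv_cl (graph_of p \<union> graph_of (finv q)) = equiv_cl (graph_of p \<union> graph_of q)"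
  proof (rule equiv_cl_eqI)
    have "graph_of (finv q) \<subseteq> equiv_cl (graph_of q)" "graph_of q \<subseteq> equiv_cl (graph_of (finv q))"
      using equiv_cl_superset[of "graph_of (finv q)"] equiv_cl_superset[of "graph_of q"] q by simp_all
    then show "graph_of p \<union> graph_of (finv q) \<subseteq> equiv_cl (graph_of p \<union> graph_of q)"
      "graph_of p \<union> graph_of q \<subseteq> equiv_cl (graph_of p \<union> graph_of (finv q))"
      using graph_subset_connected[of q "graph_of p"] graph_subset_connected[of "finv q" "graph_of p"]
        equiv_cl_superset[of "graph_of p \<union> graph_of q"] equiv_cl_superset[of "graph_of p \<union> graph_of (finv q)"]
      unfolding Un_commute[of "graph_of p"] by simp_all
  qed
  then show ?thesis using comp q by (simp add: planar_def euler_def num_classes_def)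
qed

section \<open>Unions of components\<close>

lemma perm_restrict_permutes:
  assumes "finite D" "p permutes D" "K \<subseteq> D" "p ` K \<subseteq> K"
  shows "perm_restrict p K permutes K"
proof (rule bij_imp_permutes)
  have "inj_on p K" using assms(2) by (meson permutes_inj inj_on_subset subset_UNIV)
  then have "bij_betw p K K"
    using assms by (simp add: bij_betw_def endo_inj_surj finite_subset)
  then show "bij_betw (perm_restrict p K) K K"
    by (rule bij_betw_cong[THEN iffD1, rotated]) (simp add: perm_restrict_simps)
qed (simp add: perm_restrict_simps)

lemma preimage_closed:
  assumes "finite D" "p permutes D" "K \<subseteq> D" "p ` K \<subseteq> K"
  shows "p x \<in> K \<longleftrightarrow> x \<in> K"
proof -
  have "p ` K = K"
    using assms by (metis endo_inj_surj finite_subset permutes_inj inj_on_subset subset_UNIV)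
  then show ?thesis using assms(2) by (metis permutes_inj inj_image_mem_iff)
qed

text \<open>
  A chain of related points that starts in \<open>K\<close> stays in \<open>K\<close> and only uses pairs inside \<open>K\<close>.
\<close>

lemma num_classes_restrict:
  assumes R: "\<And>u v. (u, v) \<in> R \<Longrightarrow> u \<in> K \<longleftrightarrow> v \<in> K"
    and S: "S \<subseteq> R \<union> Id" "\<And>u v. (u, v) \<in> R \<Longrightarrow> u \<in> K \<Longrightarrow> (u, v) \<in> S"
  shows "num_classes K R = num_classes K S"
proof (rule num_classes_cong)
  fix x assume x: "x \<in> K"
  have "equiv_cl S \<subseteq> equiv_cl R" using S(1) by (intro equiv_cl_subset) (auto intro: equiv_cl_base)
  moreover have "(x, y) \<in> equiv_cl S" if "(x, y) \<in> equiv_cl R" for y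
  proof -
    have "((x, u) \<in> equiv_cl S \<and> u \<in> K) = ((x, v) \<in> equiv_cl S \<and> v \<in> K)" if "(u, v) \<in> R" for u v
    proof (cases "u \<in> K")
      case True
      then have "(u, v) \<in> equiv_cl S" "v \<in> K" using that S(2) R by (auto intro: equiv_cl_base)
      then show ?thesis using True by (meson equiv_cl_sym equiv_cl_trans)
    qed (use R that in auto)
    then have "((x, x) \<in> equiv_cl S \<and> x \<in> K) = ((x, y) \<in> equiv_cl S \<and> y \<in> K)"
      by (rule equiv_cl_invariant[OF that])
    then show ?thesis using x by simp
  qed
  ultimately show "equiv_cl R `` {x} = equiv_cl S `` {x}" by auto
qed

lemma euler_decompose:
  assumes D: "finite D" and p: "p permutes D" "p ` K \<subseteq> K" and q: "q permutes D" "q ` K \<subseteq> K"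
    and K: "K \<subseteq> D"
  shows "euler D p q = euler K (perm_restrict p K) (perm_restrict q K) +
    euler (D - K) (perm_restrict p (D - K)) (perm_restrict q (D - K))"
proof -
  let ?r = perm_restrict
  have pK: "p x \<in> K \<longleftrightarrow> x \<in> K" and qK: "q x \<in> K \<longleftrightarrow> x \<in> K"
    and pD: "p x \<in> D \<longleftrightarrow> x \<in> D" and qD: "q x \<in> D \<longleftrightarrow> x \<in> D" for x
    using preimage_closed[OF D _ K] p q by (auto simp: permutes_in_image)
  have split: "num_classes D R = num_classes K R + num_classes (D - K) R"
    if "\<And>u v. (u, v) \<in> R \<Longrightarrow> u \<in> K \<longleftrightarrow> v \<in> K" for R
    using num_classes_Un[OF D K that] .
  have *: "num_classes L (graph_of p) = num_classes L (graph_of (?r p L))"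
    "num_classes L (graph_of q) = num_classes L (graph_of (?r q L))"
    "num_classes L (graph_of (q \<circ> p)) = num_classes L (graph_of (?r q L \<circ> ?r p L))"
    "num_classes L (graph_of p \<union> graph_of q) = num_classes L (graph_of (?r p L) \<union> graph_of (?r q L))"
    if "L = K \<or> L = D - K" for L
  proof -
    have L: "p x \<in> L \<longleftrightarrow> x \<in> L" "q x \<in> L \<longleftrightarrow> x \<in> L" for x
      using that by (auto simp: pK qK pD qD)
    show "num_classes L (graph_of p) = num_classes L (graph_of (?r p L))"
      "num_classes L (graph_of q) = num_classes L (graph_of (?r q L))"
      "num_classes L (graph_of (q \<circ> p)) = num_classes L (graph_of (?r q L \<circ> ?r p L))"
      "num_classes L (graph_of p \<union> graph_of q) = num_classes L (graph_of (?r p L) \<union> graph_of (?r q L))"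
      by (rule num_classes_restrict; auto simp: graph_of_def perm_restrict_def L split: if_splits)+
  qed
  have "num_classes D (graph_of p) = num_classes K (graph_of p) + num_classes (D - K) (graph_of p)"
    by (rule split) (auto simp: pK)
  moreover have "num_classes D (graph_of q) = num_classes K (graph_of q) + num_classes (D - K) (graph_of q)"
    by (rule split) (auto simp: qK)
  moreover have "num_classes D (graph_of (q \<circ> p)) =
      num_classes K (graph_of (q \<circ> p)) + num_classes (D - K) (graph_of (q \<circ> p))"
    by (rule split) (auto simp: pK qK)
  moreover have "num_classes D (graph_of p \<union> graph_of q) =
      num_classes K (graph_of p \<union> graph_of q) + num_classes (D - K) (graph_of p \<union> graph_of q)"
    by (rule split) (auto simp: pK qK)
  ultimately show ?thesis by (simp add: euler_def *)
qed

text \<open>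
  By \<open>euler_le\<close> neither of the two summands of \<open>euler_decompose\<close> exceeds its number of points. Equality for
  the sum therefore forces equality for both.
\<close>

lemma planar_restrict:
  assumes D: "finite D" and p: "p permutes D" "p ` K \<subseteq> K" and q: "q permutes D" "q ` K \<subseteq> K"
    and K: "K \<subseteq> D" and planar: "planar D p q"
  shows "planar K (perm_restrict p K) (perm_restrict q K)"
proof -
  have fin: "finite K" using D K by (rule finite_subset[rotated])
  have pc: "p ` (D - K) \<subseteq> D - K" "q ` (D - K) \<subseteq> D - K"
    by (auto simp: preimage_closed[OF D p(1) K p(2)] preimage_closed[OF D q(1) K q(2)]
        permutes_in_image[OF p(1)] permutes_in_image[OF q(1)])
  have "euler K (perm_restrict p K) (perm_restrict q K) \<le> int (card K)"
    by (intro euler_le fin perm_restrict_permutes[OF D _ K] p q)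
  moreover have "euler (D - K) (perm_restrict p (D - K)) (perm_restrict q (D - K)) \<le> int (card (D - K))"
    by (intro euler_le finite_Diff D perm_restrict_permutes[OF D _ Diff_subset] p q pc)
  moreover have "int (card D) = int (card K) + int (card (D - K))"
    using card_Diff_subset[OF fin K] card_mono[OF D K] by simp
  ultimately show ?thesis
    using euler_decompose[OF D p q K] planar by (simp add: planar_def)
qed

lemma planar_disjoint_union:
  assumes "finite D1" "finite D2" "D1 \<inter> D2 = {}"
    and p: "p1 permutes D1" "p2 permutes D2" and q: "q1 permutes D1" "q2 permutes D2"
    and "planar D1 p1 q1" "planar D2 p2 q2"
  shows "planar (D1 \<union> D2) (p1 \<circ> p2) (q1 \<circ> q2)"
proof -
  have rest: "perm_restrict (f1 \<circ> f2) D1 = f1" "perm_restrict (f1 \<circ> f2) D2 = f2"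
      "(f1 \<circ> f2) ` D1 \<subseteq> D1" "f1 \<circ> f2 permutes (D1 \<union> D2)"
    if f: "f1 permutes D1" "f2 permutes D2" for f1 f2
  proof -
    have 1: "f2 x = x" if "x \<in> D1" for x
      using f(2) assms(3) that by (metis disjoint_iff permutes_not_in)
    have 2: "f1 (f2 x) = f2 x" if "x \<in> D2" for x
      using f assms(3) that by (metis disjoint_iff permutes_not_in permutes_in_image)
    show "perm_restrict (f1 \<circ> f2) D1 = f1" "perm_restrict (f1 \<circ> f2) D2 = f2"
      using f 1 2 by (auto simp: perm_restrict_def fun_eq_iff permutes_not_in)
    show "(f1 \<circ> f2) ` D1 \<subseteq> D1" using f 1 by (auto simp: permutes_in_image)
    show "f1 \<circ> f2 permutes (D1 \<union> D2)"
      using f by (meson permutes_compose permutes_subset sup_ge1 sup_ge2)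
  qed
  have D2: "D1 \<union> D2 - D1 = D2" using assms(3) by auto
  have "euler (D1 \<union> D2) (p1 \<circ> p2) (q1 \<circ> q2) = euler D1 p1 q1 + euler D2 p2 q2"
    using euler_decompose[of "D1 \<union> D2" "p1 \<circ> p2" D1 "q1 \<circ> q2"] rest[OF p] rest[OF q] assms(1,2)
    by (simp add: D2)
  then show ?thesis using assms by (simp add: planar_def card_Un_disjoint)
qed

section \<open>Transpositions that preserve planarity\<close>

text \<open>
  Splitting a cycle cannot decrease \<open>euler D p q\<close>, and \<open>euler_le\<close> says that it cannot increase it
  beyond \<open>card D\<close> either.
\<close>

lemma planar_split:
  assumes "finite D" "p permutes D" "q permutes D" "a \<in> D" "b \<in> D" "a \<noteq> b"
    and "planar D p q" "(a, b) \<in> equiv_cl (graph_of p)"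
  shows "planar D (p \<circ> transpose a b) q"
  using euler_split[OF assms(1-6,8)] assms(7)
    euler_le[OF assms(1) permutes_comp_transpose[OF assms(2,4,5)] assms(3)]
  by (simp add: planar_def)

text \<open>
  If \<open>a\<close> and \<open>b\<close> were still connected, the two new cycles, one of \<open>p\<close> and one of
  \<open>q \<circ> p\<close>, would violate \<open>euler_le\<close>. This is the
  combinatorial form of the Jordan curve theorem that is needed.
\<close>

lemma planar_split_separates:
  assumes "finite D" "p permutes D" "q permutes D" "a \<in> D" "b \<in> D" "a \<noteq> b"
    and "planar D p q" "(a, b) \<in> equiv_cl (graph_of p)" "(a, b) \<in> equiv_cl (graph_of (q \<circ> p))"
  shows "(a, b) \<notin> equiv_cl (graph_of (p \<circ> transpose a b) \<union> graph_of q)"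
  using euler_nonseparating[OF assms(1-6,8,9)] assms(7)
    euler_le[OF assms(1) permutes_comp_transpose[OF assms(2,4,5)] assms(3)]
  by (auto simp add: planar_def)

lemma planar_free_join:
  assumes "finite D" "p permutes D" "q permutes D" "a \<in> D" "b \<in> D" "a \<noteq> b"
    and "planar D p q" "(a, b) \<notin> equiv_cl (graph_of p)" "(a, b) \<in> equiv_cl (graph_of (q \<circ> p))"
  shows "planar D (p \<circ> transpose a b) q"
  using euler_free_join[OF assms(1-6,8,9)] assms(7) by (simp add: planar_def)

lemma planar_join:
  assumes "finite D" "p permutes D" "q permutes D" "a \<in> D" "b \<in> D" "a \<noteq> b"
    and "planar D p q" "(a, b) \<notin> equiv_cl (graph_of p \<union> graph_of q)"
  shows "planar D (p \<circ> transpose a b) q"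
  using euler_join[OF assms(1-6,8)] assms(7) by (simp add: planar_def)

section \<open>Faces as lists of darts\<close>

text \<open>
  The list \<open>xs\<close> is a complete cycle of \<open>p\<close>, read from some starting point. The empty list is allowed
  on purpose: it is the boundary of a hole with empty boundary word.
\<close>

definition cyc :: "('d \<Rightarrow> 'd) \<Rightarrow> 'd list \<Rightarrow> bool" where
  "cyc p xs \<longleftrightarrow> distinct xs \<and> map p xs = rotate1 xs"

lemma cyc_Nil [simp]: "cyc p []"
  by (simp add: cyc_def)

lemma rotate1_snoc: "rotate1 (xs @ [x]) = tl (xs @ [x]) @ [hd (xs @ [x])]"
  by (cases xs) auto

lemma cyc_snoc_iff:
  "cyc p (xs @ [x]) \<longleftrightarrow> distinct (xs @ [x]) \<and> map p xs = tl (xs @ [x]) \<and> p x = hd (xs @ [x])"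
  by (simp add: cyc_def rotate1_snoc del: rotate1.simps)

lemma cyc_rotate: "cyc p (xs @ ys) \<Longrightarrow> cyc p (ys @ xs)"
proof -
  have "cyc p (rotate n zs)" if "cyc p zs" for n zs
    using that by (induction n) (simp_all add: cyc_def rotate1_map[symmetric])
  from this[of "xs @ ys" "length xs"] show "cyc p (xs @ ys) \<Longrightarrow> cyc p (ys @ xs)"
    by (simp add: rotate_append)
qed

lemma cyc_cong: "(\<And>x. x \<in> set xs \<Longrightarrow> p x = q x) \<Longrightarrow> cyc p xs \<longleftrightarrow> cyc q xs"
  by (simp add: cyc_def cong: map_cong)

lemma cyc_congI: "cyc p xs \<Longrightarrow> (\<And>x. x \<in> set xs \<Longrightarrow> p x = q x) \<Longrightarrow> cyc q xs"
  using cyc_cong by metis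

lemma cyc_image: "cyc p xs \<Longrightarrow> p ` set xs = set xs"
  unfolding cyc_def by (metis set_map set_rotate1)

lemma cyc_last: "cyc p xs \<Longrightarrow> xs \<noteq> [] \<Longrightarrow> p (last xs) = hd xs"
  by (metis cyc_snoc_iff rev_exhaust last_snoc)

lemma path_subset_closed:
  assumes "map p u = tl (u @ [l])" "hd (u @ [l]) \<in> K" "p ` K \<subseteq> K"
  shows "set (u @ [l]) \<subseteq> K"
  using assms(1,2)
proof (induction u)
  case (Cons w u)
  have "map p u = tl (u @ [l])" "p w = hd (u @ [l])"
    using Cons.prems(1) by (cases u; simp)+
  moreover have "p w \<in> K" using Cons.prems(2) assms(3) by auto
  ultimately show ?case using Cons by auto
qed simp

lemma cyc_subset_closed:
  assumes "cyc p xs" "x \<in> set xs" "x \<in> K" "p ` K \<subseteq> K"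
  shows "set xs \<subseteq> K"
proof -
  obtain us vs where uv: "xs = us @ x # vs" using assms(2) by (meson split_list)
  have "cyc p (x # vs @ us)" using cyc_rotate[of p us "x # vs"] assms(1) uv by simp
  moreover obtain w l where wl: "x # vs @ us = w @ [l]" by (metis list.distinct(1) rev_exhaust)
  moreover have "hd (w @ [l]) = x" using wl by (metis list.sel(1))
  ultimately have "set (w @ [l]) \<subseteq> K"
    using assms(3,4) by (intro path_subset_closed[of p]) (auto simp: cyc_snoc_iff)
  then show ?thesis using uv wl by (metis Un_commute list.set(2) set_append Un_insert_left Un_insert_right)
qed

lemma cyc_snoc_split:
  "cyc p (u @ [x] @ v @ [y]) \<longleftrightarrow> distinct (u @ [x] @ v @ [y]) \<and> map p u = tl (u @ [x]) \<and>
    p x = hd (v @ [y]) \<and> map p v = tl (v @ [y]) \<and> p y = hd (u @ [x])"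
proof -
  have tl: "tl (u @ [x] @ v @ [y]) = tl (u @ [x]) @ v @ [y]" by (cases u) auto
  have hd: "hd (u @ [x] @ v @ [y]) = hd (u @ [x])" by (cases u) auto
  have v: "p x # map p v = v @ [y] \<longleftrightarrow> p x = hd (v @ [y]) \<and> map p v = tl (v @ [y])"
    by (cases v) auto
  have "map p u @ p x # map p v = tl (u @ [x]) @ v @ [y] \<longleftrightarrow>
      map p u = tl (u @ [x]) \<and> p x # map p v = v @ [y]"
    by (rule append_eq_append_conv) simp
  then show ?thesis
    using cyc_snoc_iff[of p "u @ [x] @ v" y] tl hd v by auto
qed

text \<open>
  A cycle read as two consecutive arcs that end in \<open>x\<close> and \<open>y\<close>: exchanging the successors of \<open>x\<close> and
  \<open>y\<close> closes each arc up.
\<close>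

lemma cyc_transpose_snoc:
  assumes "distinct (u @ [x] @ v @ [y])"
  shows "cyc (p \<circ> transpose x y) (u @ [x] @ v @ [y]) \<longleftrightarrow> cyc p (u @ [x]) \<and> cyc p (v @ [y])"
proof -
  have m: "map (p \<circ> transpose x y) u = map p u" "map (p \<circ> transpose x y) v = map p v"
    using assms by (auto simp: transpose_def)
  show ?thesis unfolding cyc_snoc_split cyc_snoc_iff using assms by (auto simp: m)
qed

lemma cyc_join:
  assumes "cyc p u" "cyc p v" "u \<noteq> []" "v \<noteq> []" "set u \<inter> set v = {}"
  shows "cyc (p \<circ> transpose (last u) (last v)) (u @ v)"
proof -
  obtain u' x v' y where uv: "u = u' @ [x]" "v = v' @ [y]"
    using assms(3,4) by (metis rev_exhaust)
  then have "distinct (u' @ [x] @ v' @ [y])"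
    using assms(1,2,5) by (auto simp: cyc_def)
  then show ?thesis using cyc_transpose_snoc[of u' x v' y p] assms(1,2) uv by simp
qed

lemma cyc_split:
  assumes "cyc p (u @ v)" "u \<noteq> []" "v \<noteq> []"
  shows "cyc (p \<circ> transpose (last u) (last v)) u" "cyc (p \<circ> transpose (last u) (last v)) v"
proof -
  let ?t = "transpose (last u) (last v)"
  obtain u' x v' y where uv: "u = u' @ [x]" "v = v' @ [y]"
    using assms(2,3) by (metis rev_exhaust)
  then have "distinct (u' @ [x] @ v' @ [y])"
    using assms(1) by (simp add: cyc_def)
  moreover have "p \<circ> ?t \<circ> ?t = p" by (simp add: fun_eq_iff)
  ultimately show "cyc (p \<circ> ?t) u" "cyc (p \<circ> ?t) v"
    using cyc_transpose_snoc[of u' x v' y "p \<circ> ?t"] assms(1) uv by simp_all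
qed

lemma cyc_connected_hd:
  "map p u = tl (u @ [x]) \<Longrightarrow> y \<in> set (u @ [x]) \<Longrightarrow> (hd (u @ [x]), y) \<in> equiv_cl (graph_of p)"
proof (induction u)
  case (Cons z u)
  have "map p u = tl (u @ [x])" and z: "p z = hd (u @ [x])"
    using Cons.prems(1) by (cases u; simp)+
  then have "(p z, y) \<in> equiv_cl (graph_of p)" if "y \<in> set (u @ [x])"
    using Cons.IH that by simp
  then show ?case using Cons.prems(2) equiv_cl_trans[OF equiv_cl_graph_step(2)[of z p]] by auto
qed simp

lemma cyc_connected:
  assumes "cyc p xs" "x \<in> set xs" "y \<in> set xs"
  shows "(x, y) \<in> equiv_cl (graph_of p)"
proof -
  have "xs \<noteq> []" using assms by auto
  then have "cyc p (butlast xs @ [last xs])" using assms by simp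
  then have "(hd xs, z) \<in> equiv_cl (graph_of p)" if "z \<in> set xs" for z
    using cyc_connected_hd[of p "butlast xs" "last xs" z] \<open>xs \<noteq> []\<close> that
    unfolding cyc_snoc_iff by simp
  then show ?thesis using assms by (meson equiv_cl_sym equiv_cl_trans)
qed

lemma cyc_mem_iff:
  assumes "inj p" "cyc p xs"
  shows "p x \<in> set xs \<longleftrightarrow> x \<in> set xs"
  using assms by (metis cyc_image inj_image_mem_iff)

lemma cyc_class:
  assumes "inj p" "cyc p xs" "x \<in> set xs"
  shows "equiv_cl (graph_of p) `` {x} = set xs"
proof -
  have "(x, y) \<in> equiv_cl (graph_of p) \<Longrightarrow> y \<in> set xs" for y
    using equiv_cl_invariant[of x y "graph_of p" "\<lambda>z. z \<in> set xs"] cyc_mem_iff[OF assms(1,2)] assms(3)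
    by auto
  then show ?thesis using cyc_connected[OF assms(2,3)] by auto
qed

lemma cyc_eq_or_disjoint:
  assumes "inj p" "cyc p xs" "cyc p ys" "set xs \<inter> set ys \<noteq> {}"
  shows "set xs = set ys"
  using assms cyc_class by (metis disjoint_iff)

text \<open>
  \<open>A\<close> is a union of faces that satisfy \<open>Q\<close>. The predicate \<open>Q\<close> is left open so that a hole can
  temporarily count as a face, see \<open>holed_diagram_fold\<close>.
\<close>

definition tiled :: "('d list \<Rightarrow> bool) \<Rightarrow> ('d \<Rightarrow> 'd) \<Rightarrow> 'd set \<Rightarrow> bool" where
  "tiled Q p A \<longleftrightarrow> (\<forall>d\<in>A. \<exists>fs. d \<in> set fs \<and> set fs \<subseteq> A \<and> cyc p fs \<and> Q fs)"

lemma tiled_cong: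
  assumes "tiled Q p A" "\<And>x. x \<in> A \<Longrightarrow> p x = p' x" "\<And>fs. set fs \<subseteq> A \<Longrightarrow> Q fs \<Longrightarrow> Q' fs"
  shows "tiled Q' p' A"
  unfolding tiled_def
proof
  fix d assume "d \<in> A"
  then obtain fs where fs: "d \<in> set fs" "set fs \<subseteq> A" "cyc p fs" "Q fs"
    using assms(1) by (auto simp: tiled_def)
  moreover have "cyc p' fs" using fs cyc_cong[of fs p p'] assms(2) by auto
  ultimately show "\<exists>fs. d \<in> set fs \<and> set fs \<subseteq> A \<and> cyc p' fs \<and> Q' fs" using assms(3) by blast
qed

lemma tiled_Un: "tiled Q p A \<Longrightarrow> tiled Q p B \<Longrightarrow> tiled Q p (A \<union> B)"
  unfolding tiled_def by (meson Un_iff le_supI1 le_supI2)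

lemma tiled_face: "cyc p fs \<Longrightarrow> Q fs \<Longrightarrow> tiled Q p (set fs)"
  unfolding tiled_def by auto

lemma tiled_subset:
  assumes "tiled Q p A" "B \<subseteq> A"
    and "\<And>fs. cyc p fs \<Longrightarrow> set fs \<inter> B \<noteq> {} \<Longrightarrow> set fs \<subseteq> A \<Longrightarrow> set fs \<subseteq> B"
  shows "tiled Q p B"
  unfolding tiled_def
proof
  fix d assume d: "d \<in> B"
  then obtain fs where "d \<in> set fs" "set fs \<subseteq> A" "cyc p fs" "Q fs"
    using assms(1,2) unfolding tiled_def by blast
  moreover from this have "set fs \<subseteq> B" using assms(3)[of fs] d by blast
  ultimately show "\<exists>fs. d \<in> set fs \<and> set fs \<subseteq> B \<and> cyc p fs \<and> Q fs" by blast
qed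

lemma tiled_remove_face:
  assumes "inj p" "tiled Q p A" "cyc p gs"
  shows "tiled Q p (A - set gs)"
proof (rule tiled_subset[OF assms(2)])
  fix fs assume "cyc p fs" "set fs \<inter> (A - set gs) \<noteq> {}" "set fs \<subseteq> A"
  then show "set fs \<subseteq> A - set gs" using cyc_eq_or_disjoint[OF assms(1) _ assms(3), of fs] by blast
qed auto

lemma tiled_closed_part:
  assumes "tiled Q p A" "p ` K \<subseteq> K"
  shows "tiled Q (perm_restrict p K) (A \<inter> K)"
proof (rule tiled_cong)
  show "tiled Q p (A \<inter> K)"
  proof (rule tiled_subset[OF assms(1)])
    fix fs assume fs: "cyc p fs" "set fs \<inter> (A \<inter> K) \<noteq> {}" "set fs \<subseteq> A"
    then obtain x where x: "x \<in> set fs" "x \<in> K" by blast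
    have "set fs \<subseteq> K" by (rule cyc_subset_closed[OF fs(1) x assms(2)])
    then show "set fs \<subseteq> A \<inter> K" using fs(3) by blast
  qed auto
qed (auto simp: perm_restrict_simps)

section \<open>Cutting and gluing planar maps\<close>

text \<open>
  A disjoint union of combinatorial maps on spheres. Unlike a \<open>spherical_map\<close> it may be disconnected or
  empty, and this makes the class closed under all surgeries below.
\<close>

definition planar_map :: "'d set \<Rightarrow> ('d \<Rightarrow> 'd) \<Rightarrow> ('d \<Rightarrow> 'd) \<Rightarrow> bool" where
  "planar_map D \<alpha> \<phi> \<longleftrightarrow> finite D \<and> \<alpha> permutes D \<and> \<phi> permutes D \<and>
    (\<forall>d\<in>D. \<alpha> d \<noteq> d) \<and> (\<forall>d. \<alpha> (\<alpha> d) = d) \<and> planar D \<alpha> \<phi>"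

lemma planar_mapD:
  assumes "planar_map D \<alpha> \<phi>"
  shows "finite D" "\<alpha> permutes D" "\<phi> permutes D" "\<And>d. d \<in> D \<Longrightarrow> \<alpha> d \<noteq> d" "\<And>d. \<alpha> (\<alpha> d) = d"
    "planar D \<alpha> \<phi>" "planar D \<phi> \<alpha>" "\<And>d. \<alpha> d \<in> D \<longleftrightarrow> d \<in> D" "\<And>d. \<phi> d \<in> D \<longleftrightarrow> d \<in> D"
    "inj \<phi>"
  using assms planar_commute[of \<alpha> D \<phi>]
  by (auto simp: planar_map_def permutes_in_image permutes_inj)

lemma planar_map_change_faces:
  assumes "planar_map D \<alpha> \<phi>" "a \<in> D" "b \<in> D" "planar D (\<phi> \<circ> transpose a b) \<alpha>"
  shows "planar_map D \<alpha> (\<phi> \<circ> transpose a b)"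
  using assms permutes_comp_transpose[of \<phi> D a b] planar_commute[of "\<phi> \<circ> transpose a b" D \<alpha>]
  by (auto simp: planar_map_def)

lemma planar_map_split_face:
  assumes pm: "planar_map D \<alpha> \<phi>" and cyc: "cyc \<phi> (u @ v)" "set (u @ v) \<subseteq> D" "u \<noteq> []" "v \<noteq> []"
  shows "planar_map D \<alpha> (\<phi> \<circ> transpose (last u) (last v))"
proof (rule planar_map_change_faces[OF pm])
  note pm' = planar_mapD[OF pm]
  have uv: "last u \<in> set (u @ v)" "last v \<in> set (u @ v)" using cyc by auto
  then show D: "last u \<in> D" "last v \<in> D" using cyc by auto
  have "last u \<noteq> last v" using cyc by (auto simp: cyc_def disjoint_iff) (metis last_in_set)
  then show "planar D (\<phi> \<circ> transpose (last u) (last v)) \<alpha>"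
    using planar_split[OF pm'(1,3,2) D _ pm'(7) cyc_connected[OF cyc(1) uv]] by simp
qed

text \<open>
  Merging the faces on both sides of the edge of \<open>d\<close>, in such a way that \<open>d\<close> and \<open>\<alpha> d\<close> become
  consecutive on the new face. The two corners that are merged lie at the same vertex, since the last
  dart of the second face is sent to \<open>d\<close> by \<open>\<alpha> \<circ> \<phi>\<close>; so this is a free join.
\<close>

lemma planar_map_join_across:
  assumes pm: "planar_map D \<alpha> \<phi>" and cyc: "cyc \<phi> (u @ [d])" "cyc \<phi> (\<alpha> d # v)"
    and d: "d \<in> D" and disj: "set (u @ [d]) \<inter> set (\<alpha> d # v) = {}" and sub: "set v \<subseteq> D"
  shows "planar_map D \<alpha> (\<phi> \<circ> transpose d (last (\<alpha> d # v)))"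
    "cyc (\<phi> \<circ> transpose d (last (\<alpha> d # v))) (u @ d # \<alpha> d # v)"
proof -
  let ?y = "last (\<alpha> d # v)"
  note pm' = planar_mapD[OF pm]
  have y: "?y \<in> set (\<alpha> d # v)" by (rule last_in_set) simp
  show "cyc (\<phi> \<circ> transpose d ?y) (u @ d # \<alpha> d # v)"
    using cyc_join[OF cyc _ _ disj] by simp
  show "planar_map D \<alpha> (\<phi> \<circ> transpose d ?y)"
  proof (rule planar_map_change_faces[OF pm d])
    show yD: "?y \<in> D" using y sub d pm'(8) by auto
    have "\<phi> ?y = \<alpha> d"
      using cyc_last[OF cyc(2)] by simp
    then have "(?y, d) \<in> equiv_cl (graph_of (\<alpha> \<circ> \<phi>))"
      using equiv_cl_graph_step(2)[of ?y "\<alpha> \<circ> \<phi>"] pm'(5)[of d] by simp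
    then have conn: "(d, ?y) \<in> equiv_cl (graph_of (\<alpha> \<circ> \<phi>))" by (rule equiv_cl_sym)
    have cl: "equiv_cl (graph_of \<phi>) `` {d} = set (u @ [d])"
      by (rule cyc_class[OF pm'(10) cyc(1)]) simp
    have ny: "?y \<notin> set (u @ [d])" using disj y by blast
    then have nconn: "(d, ?y) \<notin> equiv_cl (graph_of \<phi>)" using cl by blast
    have ne: "d \<noteq> ?y" using ny by auto
    show "planar D (\<phi> \<circ> transpose d ?y) \<alpha>"
      by (rule planar_free_join[OF pm'(1,3,2) d yD ne pm'(7) nconn conn])
  qed
qed

lemma planar_map_restrict:
  assumes pm: "planar_map D \<alpha> \<phi>" and K: "K \<subseteq> D" "\<alpha> ` K \<subseteq> K" "\<phi> ` K \<subseteq> K"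
  shows "planar_map K (perm_restrict \<alpha> K) (perm_restrict \<phi> K)"
proof -
  note pm' = planar_mapD[OF pm]
  show ?thesis
    unfolding planar_map_def
  proof (intro conjI)
    show "finite K" using K(1) pm'(1) by (rule finite_subset)
    show "perm_restrict \<alpha> K permutes K" "perm_restrict \<phi> K permutes K"
      using perm_restrict_permutes[OF pm'(1) _ K(1)] K pm' by auto
    show "\<forall>d\<in>K. perm_restrict \<alpha> K d \<noteq> d"
      using K(1) pm'(4) by (auto simp: perm_restrict_def)
    show "\<forall>d. perm_restrict \<alpha> K (perm_restrict \<alpha> K d) = d"
      using K(2) pm'(5) by (auto simp: perm_restrict_def)
    show "planar K (perm_restrict \<alpha> K) (perm_restrict \<phi> K)"
      by (rule planar_restrict[OF pm'(1) pm'(2) K(2) pm'(3) K(3) K(1) pm'(6)])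
  qed
qed

text \<open>
  The consecutive edges of \<open>a\<close> and \<open>b\<close> are glued to each other: the pairs \<open>a\<close>, \<open>\<alpha> a\<close> and \<open>b\<close>, \<open>\<alpha> b\<close>
  are replaced by the pairs \<open>a\<close>, \<open>b\<close> and \<open>\<alpha> a\<close>, \<open>\<alpha> b\<close>. The first transposition joins the two edges to a
  cycle of length four. It is a free join, because \<open>\<phi> \<circ> \<alpha>\<close> sends \<open>\<alpha> a\<close> to \<open>b\<close>. The second one splits this
  cycle.
\<close>

lemma planar_map_zip:
  assumes pm: "planar_map D \<alpha> \<phi>" and ab: "a \<in> D" "b \<in> D" "a \<noteq> b" "\<alpha> a \<noteq> b" and \<phi>: "\<phi> a = b"
  defines "\<alpha>' \<equiv> \<alpha> \<circ> transpose (\<alpha> a) b \<circ> transpose a (\<alpha> b)"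
  shows "planar_map D \<alpha>' \<phi>" "\<alpha>' a = b" "\<alpha>' b = a" "\<alpha>' (\<alpha> a) = \<alpha> b" "\<alpha>' (\<alpha> b) = \<alpha> a"
    "\<And>x. x \<notin> {a, b, \<alpha> a, \<alpha> b} \<Longrightarrow> \<alpha>' x = \<alpha> x"
proof -
  note pm' = planar_mapD[OF pm]
  have ne: "\<alpha> b \<noteq> a" "\<alpha> a \<noteq> a" "\<alpha> b \<noteq> b" "\<alpha> a \<noteq> \<alpha> b"
    using ab pm'(4,5) by metis+
  show vals: "\<alpha>' a = b" "\<alpha>' b = a" "\<alpha>' (\<alpha> a) = \<alpha> b" "\<alpha>' (\<alpha> b) = \<alpha> a"
    "\<And>x. x \<notin> {a, b, \<alpha> a, \<alpha> b} \<Longrightarrow> \<alpha>' x = \<alpha> x"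
    using ab ne pm'(5) by (auto simp: \<alpha>'_def transpose_def)
  let ?\<beta> = "\<alpha> \<circ> transpose (\<alpha> a) b"
  have D: "\<alpha> a \<in> D" "\<alpha> b \<in> D" using ab pm'(8) by auto
  have \<beta>: "?\<beta> permutes D" using permutes_comp_transpose[OF pm'(2) D(1) ab(2)] .
  have nconn: "(\<alpha> a, b) \<notin> equiv_cl (graph_of \<alpha>)"
  proof
    assume "(\<alpha> a, b) \<in> equiv_cl (graph_of \<alpha>)"
    then have "(\<alpha> a \<in> {a, \<alpha> a}) = (b \<in> {a, \<alpha> a})"
    proof (rule equiv_cl_invariant)
      fix u v assume "(u, v) \<in> graph_of \<alpha>"
      then show "(u \<in> {a, \<alpha> a}) = (v \<in> {a, \<alpha> a})"
        by (metis pm'(5) graph_of_iff insert_iff empty_iff)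
    qed
    then show False using ab by simp
  qed
  have conn: "(\<alpha> a, b) \<in> equiv_cl (graph_of (\<phi> \<circ> \<alpha>))"
    using equiv_cl_graph_step(2)[of "\<alpha> a" "\<phi> \<circ> \<alpha>"] pm'(5) \<phi> by simp
  have \<beta>\<phi>: "planar D ?\<beta> \<phi>"
    by (rule planar_free_join[OF pm'(1,2,3) D(1) ab(2,4) pm'(6) nconn conn])
  have "(a, \<alpha> b) \<in> equiv_cl (graph_of ?\<beta>)"
    using equiv_cl_trans[OF equiv_cl_graph_step(2)[of a ?\<beta>] equiv_cl_graph_step(2)[of "?\<beta> a" ?\<beta>]] ab ne pm'(5)
    by (simp add: transpose_def comp_def)
  then have "planar D \<alpha>' \<phi>"
    unfolding \<alpha>'_def
    by (rule planar_split[OF pm'(1) \<beta> pm'(3) ab(1) D(2) ne(1)[symmetric] \<beta>\<phi>])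
  moreover have "\<alpha>' permutes D"
    unfolding \<alpha>'_def by (rule permutes_comp_transpose[OF \<beta> ab(1) D(2)])
  moreover have "\<alpha>' (\<alpha>' x) = x \<and> (x \<in> D \<longrightarrow> \<alpha>' x \<noteq> x)" for x
  proof (cases "x \<in> {a, b, \<alpha> a, \<alpha> b}")
    case False
    then have "\<alpha> x \<notin> {a, b, \<alpha> a, \<alpha> b}" using pm'(5) by (metis insert_iff singletonD)
    then have "\<alpha>' (\<alpha> x) = x" using vals(5)[of "\<alpha> x"] pm'(5)[of x] by simp
    then show ?thesis using vals(5)[OF False] pm'(4)[of x] by simp
  next
    case True
    then show ?thesis using ab(3) ne(4) by (auto simp: vals(1-4))
  qed
  ultimately show "planar_map D \<alpha>' \<phi>" using pm by (simp add: planar_map_def)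
qed

section \<open>Labelled diagrams with a hole\<close>

definition inv_word :: "'a word \<Rightarrow> 'a word" where
  "inv_word w = rev (map inv_letter w)"

lemma inv_word_simps [simp]:
  "inv_word [] = []"
  "inv_word (l # w) = inv_word w @ [inv_letter l]"
  "inv_word (v @ w) = inv_word w @ inv_word v"
  "inv_word (inv_word w) = w"
  by (simp_all add: inv_word_def rev_map comp_def)

text \<open>
  A van Kampen diagram seen on the sphere: the outer face is the hole \<open>h\<close>, whose labels \<open>map lab h\<close> are
  the boundary word, and \<open>Q\<close> says which other faces are allowed as 2-cells.
\<close>

definition holed_diagram ::
  "('d list \<Rightarrow> bool) \<Rightarrow> 'd set \<Rightarrow> ('d \<Rightarrow> 'd) \<Rightarrow> ('d \<Rightarrow> 'd) \<Rightarrow> ('d \<Rightarrow> 'a letter) \<Rightarrow> 'd list \<Rightarrow> bool" where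
  "holed_diagram Q D \<alpha> \<phi> lab h \<longleftrightarrow> planar_map D \<alpha> \<phi> \<and> (\<forall>d\<in>D. lab (\<alpha> d) = inv_letter (lab d)) \<and>
    set h \<subseteq> D \<and> cyc \<phi> h \<and> tiled Q \<phi> (D - set h)"

lemma holed_diagramD:
  assumes "holed_diagram Q D \<alpha> \<phi> lab h"
  shows "planar_map D \<alpha> \<phi>" "\<And>d. d \<in> D \<Longrightarrow> lab (\<alpha> d) = inv_letter (lab d)"
    "set h \<subseteq> D" "cyc \<phi> h" "tiled Q \<phi> (D - set h)" "distinct h"
  using assms by (auto simp: holed_diagram_def cyc_def)

lemma holed_diagram_rotate: "holed_diagram Q D \<alpha> \<phi> lab (u @ v) \<Longrightarrow> holed_diagram Q D \<alpha> \<phi> lab (v @ u)"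
  using cyc_rotate[of \<phi> u v] by (simp add: holed_diagram_def Un_commute)

lemma holed_diagram_cong:
  assumes "holed_diagram Q D \<alpha> \<phi> lab h" "\<And>d. d \<in> D \<Longrightarrow> lab d = lab' d"
    "\<And>fs. set fs \<subseteq> D \<Longrightarrow> Q fs \<Longrightarrow> Q' fs"
  shows "holed_diagram Q' D \<alpha> \<phi> lab' h"
proof -
  note d = holed_diagramD[OF assms(1)]
  have "lab' (\<alpha> x) = inv_letter (lab' x)" if "x \<in> D" for x
    using assms(2)[of x] assms(2)[of "\<alpha> x"] d(2)[OF that] that planar_mapD(8)[OF d(1)] by simp
  moreover have "tiled Q' \<phi> (D - set h)"
    using d(5) by (rule tiled_cong) (use assms(3) in auto)
  ultimately show ?thesis using d by (simp add: holed_diagram_def)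
qed

text \<open>
  Cancelling two inverse letters of the boundary word by gluing their edges. The last clause matters for
  the double: \<open>\<alpha>\<close> changes only at darts that are labelled by the cancelled generator.
\<close>

lemma holed_diagram_zip:
  assumes dg: "holed_diagram Q D \<alpha> \<phi> lab (u @ [a, b] @ v)" and lab: "lab b = inv_letter (lab a)"
  obtains \<alpha>' \<phi>' where "holed_diagram Q (D - {a, b}) \<alpha>' \<phi>' lab (u @ v)"
    "\<And>x. x \<in> D - {a, b} \<Longrightarrow> fst (lab x) \<noteq> fst (lab a) \<Longrightarrow> \<alpha>' x = \<alpha> x"
proof -
  let ?w = "v @ u" and ?h = "u @ [a, b] @ v"
  note d = holed_diagramD[OF dg]
  have ab: "a \<in> D" "b \<in> D" "a \<noteq> b" "a \<notin> set ?w" "b \<notin> set ?w" using d(3,6) by auto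
  have cyc: "cyc \<phi> (?w @ [a, b])" using cyc_rotate[of \<phi> "u @ [a, b]" v] d(4) by simp
  \<comment> \<open>Cut off as a bigon, the two darts form a component of their own once their edges
    are zipped, and can be dropped.\<close>
  obtain \<phi>1 where pm1: "planar_map D \<alpha> \<phi>1" and cyc1: "cyc \<phi>1 [a, b]" "cyc \<phi>1 ?w"
    and \<phi>1: "\<And>x. x \<notin> set ?h \<Longrightarrow> \<phi>1 x = \<phi> x"
  proof (cases "?w = []")
    case True
    then show ?thesis using that[of \<phi>] d(1) cyc by simp
  next
    case False
    then have "last ?w \<in> set ?w" by (rule last_in_set)
    then have "transpose (last ?w) b x = x" if "x \<notin> set ?h" for x
      using that by (intro transpose_apply_other) auto
    then show ?thesis
      using that[of "\<phi> \<circ> transpose (last ?w) b"] False d(3)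
        planar_map_split_face[OF d(1) cyc] cyc_split[OF cyc] by simp
  qed
  have \<phi>ab: "\<phi>1 a = b" "\<phi>1 b = a" using cyc1(1) by (auto simp: cyc_def)
  obtain \<alpha>1 where pm2: "planar_map D \<alpha>1 \<phi>1" and \<alpha>ab: "\<alpha>1 a = b" "\<alpha>1 b = a"
    and lab1: "\<And>x. x \<in> D \<Longrightarrow> lab (\<alpha>1 x) = inv_letter (lab x)"
    and \<alpha>1: "\<And>x. x \<in> D \<Longrightarrow> fst (lab x) \<noteq> fst (lab a) \<Longrightarrow> \<alpha>1 x = \<alpha> x"
  proof (cases "\<alpha> a = b")
    case True
    then have "\<alpha> b = a" using planar_mapD(5)[OF pm1, of a] by simp
    then show ?thesis using that[of \<alpha>] True pm1 d(2) by simp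
  next
    case False
    let ?\<alpha> = "\<alpha> \<circ> transpose (\<alpha> a) b \<circ> transpose a (\<alpha> b)"
    note z = planar_map_zip[OF pm1 ab(1-3) False \<phi>ab(1)]
    have la: "lab (\<alpha> a) = inv_letter (lab a)" "lab (\<alpha> b) = lab a" using d(2) ab lab by auto
    have "lab (?\<alpha> x) = inv_letter (lab x)" if "x \<in> D" for x
    proof (cases "x \<in> {a, b, \<alpha> a, \<alpha> b}")
      case True
      then show ?thesis using z(2-5) la lab by (elim insertE) (simp_all del: comp_apply)
    next
      case False
      then show ?thesis using z(6) d(2) that by (simp del: comp_apply)
    qed
    moreover have "?\<alpha> x = \<alpha> x" if "fst (lab x) \<noteq> fst (lab a)" for x
      using that la lab by (intro z(6)) auto
    ultimately show ?thesis using that[of ?\<alpha>] z(1-3) by blast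
  qed
  let ?K = "D - {a, b}"
  let ?\<alpha>' = "perm_restrict \<alpha>1 ?K" and ?\<phi>' = "perm_restrict \<phi>1 ?K"
  have closed: "\<alpha>1 ` ?K \<subseteq> ?K" "\<phi>1 ` ?K \<subseteq> ?K"
  proof -
    note p = planar_mapD[OF pm2]
    have "\<alpha>1 x \<in> ?K" if "x \<in> ?K" for x
      using that p(8)[of x] p(5)[of x] \<alpha>ab by auto
    then show "\<alpha>1 ` ?K \<subseteq> ?K" by blast
    have "\<phi>1 x \<in> ?K" if "x \<in> ?K" for x
      using that p(9)[of x] cyc_mem_iff[OF p(10) cyc1(1), of x] by auto
    then show "\<phi>1 ` ?K \<subseteq> ?K" by blast
  qed
  show ?thesis
  proof (rule that[of ?\<alpha>' ?\<phi>'])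
    show "?\<alpha>' x = \<alpha> x" if "x \<in> ?K" "fst (lab x) \<noteq> fst (lab a)" for x
      using that \<alpha>1 by (simp add: perm_restrict_simps)
    have "cyc ?\<phi>' ?w"
      by (rule cyc_congI[OF cyc1(2)]) (use d(3) ab(4,5) in \<open>auto simp: perm_restrict_def\<close>)
    then have "cyc ?\<phi>' (u @ v)" by (rule cyc_rotate)
    moreover have "tiled Q ?\<phi>' (?K - set (u @ v))"
    proof -
      have "?K - set (u @ v) = D - set ?h" by auto
      then show ?thesis
        by (simp only:) (rule tiled_cong[OF d(5)]; auto simp: perm_restrict_def \<phi>1)
    qed
    moreover have "lab (?\<alpha>' x) = inv_letter (lab x)" if "x \<in> ?K" for x
      using that lab1 by (simp add: perm_restrict_simps)
    ultimately show "holed_diagram Q ?K ?\<alpha>' ?\<phi>' lab (u @ v)"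
      using planar_map_restrict[OF pm2 _ closed] d(3) ab(4,5) by (auto simp: holed_diagram_def)
  qed
qed

lemma holed_diagram_zip_all:
  assumes "holed_diagram Q D \<alpha> \<phi> lab (u @ g @ g' @ v)" "map lab g' = inv_word (map lab g)"
  shows "\<exists>\<alpha>' \<phi>'. holed_diagram Q (D - set g - set g') \<alpha>' \<phi>' lab (u @ v) \<and>
    (\<forall>x\<in>D - set g - set g'. fst (lab x) \<notin> (fst \<circ> lab) ` set g \<longrightarrow> \<alpha>' x = \<alpha> x)"
  using assms
proof (induction g arbitrary: D \<alpha> \<phi> g' rule: rev_induct)
  case Nil
  then show ?case by auto
next
  case (snoc a g)
  note prems = snoc.prems
  obtain b g0 where g': "g' = b # g0" "lab b = inv_letter (lab a)" "map lab g0 = inv_word (map lab g)"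
    using prems(2) by (auto simp: map_eq_Cons_conv)
  have "holed_diagram Q D \<alpha> \<phi> lab ((u @ g) @ [a, b] @ (g0 @ v))" using prems(1) g' by simp
  from holed_diagram_zip[OF this g'(2)] obtain \<alpha>1 \<phi>1 where
    1: "holed_diagram Q (D - {a, b}) \<alpha>1 \<phi>1 lab (u @ g @ g0 @ v)"
      "\<And>x. x \<in> D - {a, b} \<Longrightarrow> fst (lab x) \<noteq> fst (lab a) \<Longrightarrow> \<alpha>1 x = \<alpha> x"
    by (metis append_assoc)
  obtain \<alpha>' \<phi>' where
    2: "holed_diagram Q (D - {a, b} - set g - set g0) \<alpha>' \<phi>' lab (u @ v)"
      "\<And>x. x \<in> D - {a, b} - set g - set g0 \<Longrightarrow> fst (lab x) \<notin> (fst \<circ> lab) ` set g \<Longrightarrow> \<alpha>' x = \<alpha>1 x"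
    using snoc.IH[OF 1(1) g'(3)] by blast
  have D: "D - {a, b} - set g - set g0 = D - set (g @ [a]) - set g'" using g' by auto
  have "\<alpha>' x = \<alpha> x"
    if "x \<in> D - set (g @ [a]) - set g'" "fst (lab x) \<notin> (fst \<circ> lab) ` set (g @ [a])" for x
    using 1(2)[of x] 2(2)[of x] g'(1) that by auto
  then show ?case using 2(1) unfolding D by blast
qed

text \<open>
  The disjoint union of two diagrams, in which the two holes are merged by identifying the vertices at
  which their boundary words start.
\<close>

lemma holed_diagram_union:
  assumes d1: "holed_diagram Q D1 \<alpha>1 \<phi>1 lab h1" and d2: "holed_diagram Q D2 \<alpha>2 \<phi>2 lab h2" and disj: "D1 \<inter> D2 = {}"
  obtains \<phi> where "holed_diagram Q (D1 \<union> D2) (\<alpha>1 \<circ> \<alpha>2) \<phi> lab (h1 @ h2)"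
    "\<And>x. x \<in> D1 \<Longrightarrow> (\<alpha>1 \<circ> \<alpha>2) x = \<alpha>1 x" "\<And>x. x \<in> D2 \<Longrightarrow> (\<alpha>1 \<circ> \<alpha>2) x = \<alpha>2 x"
proof -
  note D1 = holed_diagramD[OF d1] and D2 = holed_diagramD[OF d2]
  note p1 = planar_mapD[OF D1(1)] and p2 = planar_mapD[OF D2(1)]
  let ?D = "D1 \<union> D2" and ?\<alpha> = "\<alpha>1 \<circ> \<alpha>2" and ?\<phi> = "\<phi>1 \<circ> \<phi>2"
  have vals: "x \<in> D1 \<Longrightarrow> f2 x = x" "x \<in> D2 \<Longrightarrow> f1 (f2 x) = f2 x"
    if "f1 permutes D1" "f2 permutes D2" for f1 f2 x
    using that disj by (metis disjoint_iff permutes_not_in permutes_in_image)+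
  note a = vals[OF p1(2) p2(2)] and f = vals[OF p1(3) p2(3)]
  have pm: "planar_map ?D ?\<alpha> ?\<phi>"
    unfolding planar_map_def
  proof (intro conjI)
    show "finite ?D" using p1(1) p2(1) by simp
    show "?\<alpha> permutes ?D" "?\<phi> permutes ?D"
      using p1(2,3) p2(2,3) by (meson permutes_compose permutes_subset sup_ge1 sup_ge2)+
    show "\<forall>d\<in>?D. ?\<alpha> d \<noteq> d" using a p1(4) p2(4) by auto
    show "\<forall>d. ?\<alpha> (?\<alpha> d) = d"
    proof
      fix x
      consider "x \<in> D1" | "x \<in> D2" | "x \<notin> D1" "x \<notin> D2" by blast
      then show "?\<alpha> (?\<alpha> x) = x"
      proof cases
        case 1
        then show ?thesis using a(1)[of x] a(1)[of "\<alpha>1 x"] p1(5)[of x] p1(8)[of x] by simp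
      next
        case 2
        then show ?thesis using a(2)[of x] a(2)[of "\<alpha>2 x"] p2(5)[of x] p2(8)[of x] by simp
      next
        case 3
        then show ?thesis using p1(2) p2(2) by (simp add: permutes_not_in)
      qed
    qed
    show "planar ?D ?\<alpha> ?\<phi>"
      by (rule planar_disjoint_union[OF p1(1) p2(1) disj p1(2) p2(2) p1(3) p2(3) p1(6) p2(6)])
  qed
  have lab: "lab (?\<alpha> x) = inv_letter (lab x)" if "x \<in> ?D" for x
    using that a D1(2) D2(2) by auto
  have cyc: "cyc ?\<phi> h1" "cyc ?\<phi> h2"
    by (rule cyc_congI[OF D1(4)]; use f D1(3) in auto) (rule cyc_congI[OF D2(4)]; use f D2(3) in auto)
  have hdisj: "set h1 \<inter> set h2 = {}" using disj D1(3) D2(3) by blast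
  have tiled: "tiled Q ?\<phi> (?D - set (h1 @ h2))"
  proof -
    have "tiled Q ?\<phi> (D1 - set h1)" "tiled Q ?\<phi> (D2 - set h2)"
      by (rule tiled_cong[OF D1(5)]; use f in auto) (rule tiled_cong[OF D2(5)]; use f in auto)
    moreover have "?D - set (h1 @ h2) = (D1 - set h1) \<union> (D2 - set h2)"
      using disj D1(3) D2(3) by auto
    ultimately show ?thesis using tiled_Un by metis
  qed
  have "\<exists>\<phi>. holed_diagram Q ?D ?\<alpha> \<phi> lab (h1 @ h2)"
  proof (cases "h1 = [] \<or> h2 = []")
    case True
    then have "cyc ?\<phi> (h1 @ h2)" using cyc by auto
    then show ?thesis using pm lab D1(3) D2(3) tiled by (auto simp: holed_diagram_def)
  next
    case False
    let ?t = "transpose (last h1) (last h2)"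
    have l: "last h1 \<in> set h1" "last h2 \<in> set h2" using False by auto
    then have lD: "last h1 \<in> D1" "last h2 \<in> D2" using D1(3) D2(3) by auto
    have nconn: "(last h1, last h2) \<notin> equiv_cl (graph_of ?\<phi> \<union> graph_of ?\<alpha>)"
    proof
      assume "(last h1, last h2) \<in> equiv_cl (graph_of ?\<phi> \<union> graph_of ?\<alpha>)"
      then have "(last h1 \<in> D1) = (last h2 \<in> D1)"
      proof (rule equiv_cl_invariant)
        fix x y assume "(x, y) \<in> graph_of ?\<phi> \<union> graph_of ?\<alpha>"
        then consider "y = \<phi>1 (\<phi>2 x)" | "y = \<alpha>1 (\<alpha>2 x)" by auto
        then show "(x \<in> D1) = (y \<in> D1)"
          using p1(8,9) p2(8,9) a(1) f(1) p2(2,3) disj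
          by cases (metis disjoint_iff permutes_not_in)+
      qed
      then show False using lD disj by blast
    qed
    have "planar_map ?D ?\<alpha> (?\<phi> \<circ> ?t)"
    proof (rule planar_map_change_faces[OF pm])
      show "last h1 \<in> ?D" "last h2 \<in> ?D" using lD by auto
      then show "planar ?D (?\<phi> \<circ> ?t) ?\<alpha>"
        using planar_mapD[OF pm] nconn l hdisj by (intro planar_join) auto
    qed
    moreover have "cyc (?\<phi> \<circ> ?t) (h1 @ h2)"
      using cyc_join[OF cyc] False hdisj by simp
    moreover have "tiled Q (?\<phi> \<circ> ?t) (?D - set (h1 @ h2))"
      using tiled
    proof (rule tiled_cong)
      fix x assume "x \<in> ?D - set (h1 @ h2)"
      then have "?t x = x" using l by (intro transpose_apply_other) auto
      then show "?\<phi> x = (?\<phi> \<circ> ?t) x" by simp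
    qed
    ultimately show ?thesis using lab D1(3) D2(3) by (auto simp: holed_diagram_def)
  qed
  then show ?thesis using that a by auto
qed

text \<open>
  Removing two mirror image faces that meet along the edge of \<open>d\<close>. They are merged to one face across
  this edge; the boundary word of that face has the form \<open>v v\<^sup>-\<^sup>1\<close>, so it can be zipped up completely.
\<close>

lemma holed_diagram_fold:
  assumes dg: "holed_diagram Q D \<alpha> \<phi> lab h" and d: "d \<in> D"
    and fs: "cyc \<phi> (ds @ [d])" "cyc \<phi> (\<alpha> d # es)" "set (ds @ [d]) \<inter> set (\<alpha> d # es) = {}"
    and sub: "set (ds @ [d]) \<subseteq> D - set h" "set (\<alpha> d # es) \<subseteq> D - set h"
    and lab: "map lab es = inv_word (map lab ds)"
  obtains \<alpha>' \<phi>' where "holed_diagram Q (D - set (ds @ [d]) - set (\<alpha> d # es)) \<alpha>' \<phi>' lab h"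
proof -
  note dd = holed_diagramD[OF dg]
  let ?e = "\<alpha> d" and ?F = "set (ds @ [d]) \<union> set (\<alpha> d # es)"
  let ?t = "transpose d (last (?e # es))"
  have inj: "inj \<phi>" using planar_mapD[OF dd(1)] by simp
  have "set es \<subseteq> D" using sub(2) by auto
  note j = planar_map_join_across[OF dd(1) fs(1,2) d fs(3) this]
  have t: "?t x = x" if "x \<notin> ?F" for x
    using that last_in_set[of "?e # es"] by (intro transpose_apply_other) auto
  \<comment> \<open>The merged face becomes the hole. The old hole \<open>h\<close> survives the zipping because it counts
    as a face; no other face meets it, so it can be recognised afterwards.\<close>
  let ?Q = "\<lambda>gs. Q gs \<and> set gs \<inter> set h = {} \<or> gs = h"
  have "tiled ?Q (\<phi> \<circ> ?t) (D - ?F)"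
  proof -
    have "tiled ?Q \<phi> (D - set h - set (ds @ [d]) - set (?e # es))"
    proof (rule tiled_remove_face[OF inj _ fs(2)], rule tiled_remove_face[OF inj _ fs(1)])
      show "tiled ?Q \<phi> (D - set h)" using dd(5) by (rule tiled_cong) auto
    qed
    moreover have "tiled ?Q \<phi> (set h)" using dd(4) by (intro tiled_face) auto
    ultimately have "tiled ?Q \<phi> ((D - set h - set (ds @ [d]) - set (?e # es)) \<union> set h)"
      by (rule tiled_Un)
    also have "(D - set h - set (ds @ [d]) - set (?e # es)) \<union> set h = D - ?F"
      using sub dd(3) by auto
    finally show ?thesis
    proof (rule tiled_cong)
      fix x assume "x \<in> D - ?F"
      then show "\<phi> x = (\<phi> \<circ> ?t) x" using t[of x] by simp
    qed
  qed
  moreover have hole: "[] @ (ds @ [d]) @ (?e # es) @ [] = ds @ d # ?e # es" "set (ds @ d # ?e # es) = ?F"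
    by auto
  moreover have "?F \<subseteq> D" using sub by blast
  ultimately have "holed_diagram ?Q D \<alpha> (\<phi> \<circ> ?t) lab ([] @ (ds @ [d]) @ (?e # es) @ [])"
    unfolding holed_diagram_def hole using j dd(2) by blast
  moreover have "map lab (?e # es) = inv_word (map lab (ds @ [d]))" using lab dd(2)[OF d] by simp
  ultimately obtain \<alpha>' \<phi>' where
    new: "holed_diagram ?Q (D - set (ds @ [d]) - set (?e # es)) \<alpha>' \<phi>' lab ([] @ [])"
    using holed_diagram_zip_all by blast
  let ?D = "D - set (ds @ [d]) - set (?e # es)"
  note nd = holed_diagramD[OF new]
  have tl: "tiled ?Q \<phi>' ?D" using nd(5) by simp
  have hD: "set h \<subseteq> ?D" using sub dd(3) by auto
  have cyc: "cyc \<phi>' h"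
  proof (cases h)
    case (Cons x h')
    then show ?thesis using tl hD unfolding tiled_def by fastforce
  qed simp
  have "tiled ?Q \<phi>' (?D - set h)"
    using planar_mapD(10)[OF nd(1)] tl cyc by (rule tiled_remove_face)
  then have tl': "tiled ?Q \<phi>' (?D - set h)" .
  have "tiled Q \<phi>' (?D - set h)"
    unfolding tiled_def
  proof
    fix x assume x: "x \<in> ?D - set h"
    then obtain fs where fs: "x \<in> set fs" "set fs \<subseteq> ?D - set h" "cyc \<phi>' fs" "?Q fs"
      using tl' unfolding tiled_def by blast
    then have "fs \<noteq> h" using x by blast
    then show "\<exists>fs. x \<in> set fs \<and> set fs \<subseteq> ?D - set h \<and> cyc \<phi>' fs \<and> Q fs"
      using fs by blast
  qed
  then have "holed_diagram Q ?D \<alpha>' \<phi>' lab h" using nd(1,2) hD cyc by (simp add: holed_diagram_def)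
  then show ?thesis by (rule that)
qed

lemma holed_diagram_conj:
  assumes f: "bij f" and dg: "holed_diagram Q D \<alpha> \<phi> lab h"
  shows "holed_diagram (\<lambda>fs. Q (map (finv f) fs)) (f ` D) (f \<circ> \<alpha> \<circ> finv f) (f \<circ> \<phi> \<circ> finv f) (lab \<circ> finv f) (map f h)"
proof -
  note d = holed_diagramD[OF dg]
  note p = planar_mapD[OF d(1)]
  have inv_eq [simp]: "finv f (f x) = x" "f (finv f y) = y" for x y
    using f by (simp_all add: bij_is_inj bij_is_surj surj_f_inv_f)
  have cyc: "cyc (f \<circ> \<phi> \<circ> finv f) (map f xs)" if "cyc \<phi> xs" for xs
  proof -
    have "map (f \<circ> \<phi> \<circ> finv f) (map f xs) = map f (map \<phi> xs)" by simp
    also have "\<dots> = rotate1 (map f xs)" using that by (simp add: cyc_def rotate1_map)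
    finally show ?thesis
      using that inj_on_subset[OF bij_is_inj[OF f] subset_UNIV] by (simp add: cyc_def distinct_map)
  qed
  have perm: "f \<circ> g \<circ> finv f permutes f ` D" if "g permutes D" for g
  proof (rule bij_imp_permutes)
    have "f \<circ> g \<circ> finv f \<circ> f = f \<circ> g" by (simp add: fun_eq_iff)
    moreover have "bij_betw (f \<circ> g) D (f ` D)"
      using permutes_imp_bij[OF that] f by (meson bij_betw_imageI bij_betw_trans bij_is_inj inj_on_subset subset_UNIV)
    moreover have "bij_betw f D (f ` D)" using f by (meson bij_betw_imageI bij_is_inj inj_on_subset subset_UNIV)
    ultimately show "bij_betw (f \<circ> g \<circ> finv f) (f ` D) (f ` D)"
      using bij_betw_comp_iff[of f D "f ` D" "f \<circ> g \<circ> finv f" "f ` D"] by simp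
  next
    fix x assume "x \<notin> f ` D"
    then have "finv f x \<notin> D" by (metis image_eqI inv_eq(2))
    then show "(f \<circ> g \<circ> finv f) x = x" using that by (simp add: permutes_not_in)
  qed
  have "planar_map (f ` D) (f \<circ> \<alpha> \<circ> finv f) (f \<circ> \<phi> \<circ> finv f)"
    unfolding planar_map_def
  proof (intro conjI)
    show "\<forall>d\<in>f ` D. (f \<circ> \<alpha> \<circ> finv f) d \<noteq> d"
      using p(4) f by (auto simp: bij_is_inj inj_eq)
  qed (use p perm planar_conj[OF f] in auto)
  moreover have "tiled (\<lambda>fs. Q (map (finv f) fs)) (f \<circ> \<phi> \<circ> finv f) (f ` D - set (map f h))"
    unfolding tiled_def
  proof
    fix x assume "x \<in> f ` D - set (map f h)"
    then obtain y where y: "x = f y" "y \<in> D - set h" by auto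
    then obtain fs where fs: "y \<in> set fs" "set fs \<subseteq> D - set h" "cyc \<phi> fs" "Q fs"
      using d(5) unfolding tiled_def by blast
    have "set (map f fs) \<subseteq> f ` D - set (map f h)"
      using fs(2) f by (auto simp: bij_is_inj inj_eq)
    moreover have "map (finv f) (map f fs) = fs" by (simp add: comp_def)
    ultimately show "\<exists>fs. x \<in> set fs \<and> set fs \<subseteq> f ` D - set (map f h) \<and>
        cyc (f \<circ> \<phi> \<circ> finv f) fs \<and> Q (map (finv f) fs)"
      using fs y cyc by (intro exI[of _ "map f fs"]) auto
  qed
  ultimately show ?thesis using d cyc by (auto simp: holed_diagram_def)
qed

lemma cyc_mirror:
  assumes "bij p" "cyc p xs" shows "cyc (finv p) (rev xs)"
proof -
  have "map (finv p) (rotate1 xs) = xs"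
    using assms by (metis bij_is_inj cyc_def inv_o_cancel list.map_comp list.map_id)
  then have "map (finv p) (rev (rotate1 xs)) = rev xs" by (metis rev_map)
  moreover have "rotate1 (rev (rotate1 xs)) = rev xs" by (cases xs) auto
  ultimately show ?thesis using assms(2) by (metis cyc_def distinct_rev rotate1_map)
qed

lemma holed_diagram_mirror:
  assumes dg: "holed_diagram Q D \<alpha> \<phi> lab h"
  shows "holed_diagram (\<lambda>fs. Q (rev fs)) D \<alpha> (finv \<phi>) (inv_letter \<circ> lab) (rev h)"
proof -
  note d = holed_diagramD[OF dg]
  note p = planar_mapD[OF d(1)]
  have bij: "bij \<phi>" using p(3) by (rule permutes_bij)
  have "planar_map D \<alpha> (finv \<phi>)"
    using d(1) planar_inverse[OF p(2,3)] p(5) permutes_inv[OF p(3)]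
    by (auto simp: planar_map_def fun_eq_iff)
  moreover have "tiled (\<lambda>fs. Q (rev fs)) (finv \<phi>) (D - set h)"
    unfolding tiled_def
  proof
    fix x assume "x \<in> D - set h"
    then obtain fs where "x \<in> set fs" "set fs \<subseteq> D - set h" "cyc \<phi> fs" "Q fs"
      using d(5) unfolding tiled_def by blast
    then show "\<exists>fs. x \<in> set fs \<and> set fs \<subseteq> D - set h \<and> cyc (finv \<phi>) fs \<and> Q (rev fs)"
      using cyc_mirror[OF bij, of fs] by (intro exI[of _ "rev fs"]) auto
  qed
  ultimately show ?thesis using d cyc_mirror[OF bij d(4)] by (auto simp: holed_diagram_def)
qed

section \<open>Fillings of words\<close>

text \<open>
  A tag consists of the values \<open>cell\<close>, \<open>pos\<close> and \<open>orient\<close> of a dart of a spherical diagram.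
  The list contains the tags along the boundary of a 2-cell, which is traversed backwards if the
  orientation is reversed.
\<close>

definition face_tags :: "'a presentation \<Rightarrow> nat \<Rightarrow> bool \<Rightarrow> (nat \<times> nat \<times> bool) list" where
  "face_tags P i b = map (\<lambda>p. (i, p, b))
    (if b then [0..<length (rels P ! i)] else rev [0..<length (rels P ! i)])"

definition tag_letter :: "'a presentation \<Rightarrow> nat \<times> nat \<times> bool \<Rightarrow> 'a letter" where
  "tag_letter P = (\<lambda>(i, p, b). if b then rels P ! i ! p else inv_letter (rels P ! i ! p))"

definition flip_tag :: "nat \<times> nat \<times> bool \<Rightarrow> nat \<times> nat \<times> bool" where
  "flip_tag = (\<lambda>(i, p, b). (i, p, \<not> b))"

text \<open>
  The tags start at one end of the relator. This is no restriction, since the list \<open>fs\<close> may start at any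
  dart of its face.
\<close>

definition rel_face ::
  "'a presentation \<Rightarrow> ('d \<Rightarrow> nat \<times> nat \<times> bool) \<Rightarrow> ('d \<Rightarrow> 'a letter) \<Rightarrow> 'd list \<Rightarrow> bool" where
  "rel_face P tag lab fs \<longleftrightarrow> (\<exists>i<length (rels P). \<exists>b. map tag fs = face_tags P i b) \<and>
    (\<forall>x\<in>set fs. lab x = tag_letter P (tag x))"

lemma tag_letter_flip [simp]: "tag_letter P (flip_tag t) = inv_letter (tag_letter P t)"
  by (cases t) (simp add: tag_letter_def flip_tag_def)

lemma face_tags_flip: "face_tags P i (\<not> b) = rev (map flip_tag (face_tags P i b))"
  by (simp add: face_tags_def flip_tag_def rev_map comp_def)

lemma distinct_face_tags: "distinct (face_tags P i b)"
  by (simp add: face_tags_def distinct_map inj_on_def)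

lemma face_tags_word:
  "map (tag_letter P) (face_tags P i b) = (if b then rels P ! i else inv_word (rels P ! i))"
proof -
  have "map (tag_letter P) (face_tags P i True) = rels P ! i"
    by (simp add: face_tags_def tag_letter_def comp_def map_nth)
  moreover from this have "map (tag_letter P) (face_tags P i False) = inv_word (rels P ! i)"
  proof -
    assume T: "map (tag_letter P) (face_tags P i True) = rels P ! i"
    have "map (tag_letter P) (face_tags P i False) =
        rev (map inv_letter (map (tag_letter P) (face_tags P i True)))"
      using face_tags_flip[of P i True] by (simp add: rev_map comp_def)
    then show ?thesis by (simp only: T inv_word_def)
  qed
  ultimately show ?thesis by simp
qed

lemma rel_face_cong:
  assumes "\<And>x. x \<in> set fs \<Longrightarrow> tag x = tag' x" "\<And>x. x \<in> set fs \<Longrightarrow> lab x = lab' x"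
    and "rel_face P tag lab fs"
  shows "rel_face P tag' lab' fs"
proof -
  have m: "map tag' fs = map tag fs" using assms(1) by simp
  have "lab' x = tag_letter P (tag' x)" if "x \<in> set fs" for x
    using assms(1,2)[OF that] assms(3) that by (simp add: rel_face_def)
  then show ?thesis using assms(3) unfolding rel_face_def m by blast
qed

lemma rel_face_word:
  assumes "rel_face P tag lab fs"
  shows "\<exists>r\<in>set (rels P). map lab fs = r \<or> map lab fs = inv_word r"
proof -
  obtain i b where i: "i < length (rels P)" "map tag fs = face_tags P i b"
    and lab: "\<forall>x\<in>set fs. lab x = tag_letter P (tag x)"
    using assms by (auto simp: rel_face_def)
  have "map lab fs = map (tag_letter P) (map tag fs)" using lab by simp
  then have "map lab fs = (if b then rels P ! i else inv_word (rels P ! i))"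
    using i(2) face_tags_word[of P i b] by simp
  then show ?thesis using i(1) by (metis nth_mem)
qed

lemma words_over_inv_word [simp]: "inv_word w \<in> words_over X \<longleftrightarrow> w \<in> words_over X"
  by (induction w) auto

lemma exists_tagging:
  assumes "distinct g" "length g = length T"
  shows "\<exists>tag'. map tag' g = T \<and> (\<forall>d. d \<notin> set g \<longrightarrow> tag' d = tag d)"
  using assms(2,1)
proof (induction g T rule: list_induct2)
  case (Cons x g t T)
  then obtain tag' where "map tag' g = T" "\<forall>d. d \<notin> set g \<longrightarrow> tag' d = tag d" by auto
  then show ?case using Cons.prems by (intro exI[of _ "tag'(x := t)"]) (auto cong: map_cong)
qed auto

abbreviation "filling P D \<alpha> \<phi> lab tag h \<equiv> holed_diagram (rel_face P tag lab) D \<alpha> \<phi> lab h"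

text \<open>
  A van Kampen diagram with boundary word \<open>w\<close>. It need not be connected: spheres that were pinched off
  during the construction are kept.
\<close>

definition fillable :: "'a presentation \<Rightarrow> 'a word \<Rightarrow> bool" where
  "fillable P w \<longleftrightarrow> (\<exists>(D :: nat set) \<alpha> \<phi> lab tag h. filling P D \<alpha> \<phi> lab tag h \<and> map lab h = w)"

lemma fillableI:
  fixes D :: "nat set"
  shows "filling P D \<alpha> \<phi> lab tag h \<Longrightarrow> map lab h = w \<Longrightarrow> fillable P w"
  unfolding fillable_def by blast

lemma filling_union:
  assumes f1: "filling P D1 \<alpha>1 \<phi>1 l1 t1 h1" and f2: "filling P D2 \<alpha>2 \<phi>2 l2 t2 h2"
    and disj: "D1 \<inter> D2 = {}"
  defines "l \<equiv> \<lambda>x. if x \<in> D1 then l1 x else l2 x" and "t \<equiv> \<lambda>x. if x \<in> D1 then t1 x else t2 x"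
  obtains \<phi> where "filling P (D1 \<union> D2) (\<alpha>1 \<circ> \<alpha>2) \<phi> l t (h1 @ h2)"
    "map l (h1 @ h2) = map l1 h1 @ map l2 h2"
    "\<And>x. x \<in> D1 \<Longrightarrow> (\<alpha>1 \<circ> \<alpha>2) x = \<alpha>1 x" "\<And>x. x \<in> D2 \<Longrightarrow> (\<alpha>1 \<circ> \<alpha>2) x = \<alpha>2 x"
proof -
  have D2: "x \<notin> D1" if "x \<in> D2" for x using disj that by blast
  have 1: "holed_diagram (rel_face P t l) D1 \<alpha>1 \<phi>1 l h1"
  proof (rule holed_diagram_cong[OF f1])
    show "l1 d = l d" if "d \<in> D1" for d using that by (simp add: l_def)
    show "rel_face P t l fs" if "set fs \<subseteq> D1" "rel_face P t1 l1 fs" for fs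
      by (rule rel_face_cong[OF _ _ that(2)]) (use that(1) in \<open>auto simp: l_def t_def\<close>)
  qed
  have 2: "holed_diagram (rel_face P t l) D2 \<alpha>2 \<phi>2 l h2"
  proof (rule holed_diagram_cong[OF f2])
    show "l2 d = l d" if "d \<in> D2" for d using D2[OF that] by (simp add: l_def)
    show "rel_face P t l fs" if "set fs \<subseteq> D2" "rel_face P t2 l2 fs" for fs
    proof (rule rel_face_cong[OF _ _ that(2)])
      fix x assume "x \<in> set fs"
      then have "x \<notin> D1" using that(1) D2 by blast
      then show "t2 x = t x" "l2 x = l x" by (simp_all add: l_def t_def)
    qed
  qed
  have "map l h1 = map l1 h1" "map l h2 = map l2 h2"
    using holed_diagramD(3)[OF f1] holed_diagramD(3)[OF f2] D2 by (auto simp: l_def)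
  then have l: "map l (h1 @ h2) = map l1 h1 @ map l2 h2" by simp
  show ?thesis
  proof (rule holed_diagram_union[OF 1 2 disj])
    fix \<phi>
    assume "holed_diagram (rel_face P t l) (D1 \<union> D2) (\<alpha>1 \<circ> \<alpha>2) \<phi> l (h1 @ h2)"
      "\<And>x. x \<in> D1 \<Longrightarrow> (\<alpha>1 \<circ> \<alpha>2) x = \<alpha>1 x" "\<And>x. x \<in> D2 \<Longrightarrow> (\<alpha>1 \<circ> \<alpha>2) x = \<alpha>2 x"
    then show ?thesis using that[of \<phi>] l by blast
  qed
qed

lemma filling_rename:
  assumes "bij f" "filling P D \<alpha> \<phi> lab tag h"
  shows "filling P (f ` D) (f \<circ> \<alpha> \<circ> finv f) (f \<circ> \<phi> \<circ> finv f) (lab \<circ> finv f) (tag \<circ> finv f) (map f h)"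
    "map (lab \<circ> finv f) (map f h) = map lab h"
proof -
  have "(\<lambda>fs. rel_face P tag lab (map (finv f) fs)) = rel_face P (tag \<circ> finv f) (lab \<circ> finv f)"
    by (auto simp: rel_face_def fun_eq_iff)
  then show "filling P (f ` D) (f \<circ> \<alpha> \<circ> finv f) (f \<circ> \<phi> \<circ> finv f) (lab \<circ> finv f) (tag \<circ> finv f) (map f h)"
    using holed_diagram_conj[OF assms] by simp
  show "map (lab \<circ> finv f) (map f h) = map lab h"
    using assms(1) by (simp add: bij_is_inj)
qed

lemma filling_mirror:
  assumes "filling P D \<alpha> \<phi> lab tag h"
  shows "filling P D \<alpha> (finv \<phi>) (inv_letter \<circ> lab) (flip_tag \<circ> tag) (rev h)"
    "map (inv_letter \<circ> lab) (rev h) = inv_word (map lab h)"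
proof -
  have "rel_face P (flip_tag \<circ> tag) (inv_letter \<circ> lab) fs" if fs: "rel_face P tag lab (rev fs)" for fs
  proof -
    obtain i b where i: "i < length (rels P)" "map tag (rev fs) = face_tags P i b"
      using fs by (auto simp: rel_face_def)
    then have "map (flip_tag \<circ> tag) fs = face_tags P i (\<not> b)"
      using face_tags_flip[of P i b] by (simp add: rev_map rev_swap flip: i(2))
    then show ?thesis using i(1) fs by (auto simp: rel_face_def)
  qed
  then show "filling P D \<alpha> (finv \<phi>) (inv_letter \<circ> lab) (flip_tag \<circ> tag) (rev h)"
    by (intro holed_diagram_cong[OF holed_diagram_mirror[OF assms]]) auto
  show "map (inv_letter \<circ> lab) (rev h) = inv_word (map lab h)"
    by (simp add: inv_word_def rev_map)
qed

lemma exists_fresh_renaming: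
  fixes D D' :: "nat set"
  assumes "finite D" "finite D'"
  obtains f where "bij f" "D \<inter> f ` D' = {}"
proof -
  obtain N where N: "\<forall>x\<in>D \<union> D'. x < N" using assms by (metis finite_UnI finite_nat_set_iff_bounded)
  let ?f = "\<lambda>x. if x < N then x + N else if x < 2 * N then x - N else x"
  have "?f (?f x) = x" for x by auto
  then have "bij ?f" by (rule involuntory_imp_bij)
  moreover have "D \<inter> ?f ` D' = {}"
  proof -
    have "?f y \<notin> D" if "y \<in> D'" for y using N that by fastforce
    then show ?thesis by blast
  qed
  ultimately show ?thesis by (rule that)
qed

lemma fillable_Nil: "fillable P []"
proof -
  have "holed_diagram (rel_face P (\<lambda>_. undefined) (\<lambda>_. undefined)) ({} :: nat set) id id (\<lambda>_. undefined) []"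
    by (simp add: holed_diagram_def planar_map_def planar_def euler_def num_classes_def tiled_def permutes_id)
  then show ?thesis unfolding fillable_def by blast
qed

lemma fillable_rotate: "fillable P (u @ v) \<Longrightarrow> fillable P (v @ u)"
proof -
  assume "fillable P (u @ v)"
  then obtain D :: "nat set" and \<alpha> \<phi> lab tag h where
    f: "filling P D \<alpha> \<phi> lab tag h" "map lab h = u @ v"
    unfolding fillable_def by blast
  then obtain hu hv where "h = hu @ hv" "map lab hu = u" "map lab hv = v"
    by (auto simp: map_eq_append_conv)
  moreover from this have "filling P D \<alpha> \<phi> lab tag (hv @ hu)"
    using holed_diagram_rotate[of _ D \<alpha> \<phi> lab hu hv] f(1) by simp
  ultimately show "fillable P (v @ u)" by (intro fillableI) auto
qed

lemma fillable_append:
  assumes "fillable P u" "fillable P v"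
  shows "fillable P (u @ v)"
proof -
  obtain D1 :: "nat set" and \<alpha>1 \<phi>1 l1 t1 h1 where
    f1: "filling P D1 \<alpha>1 \<phi>1 l1 t1 h1" "map l1 h1 = u"
    using assms(1) unfolding fillable_def by blast
  obtain D2 :: "nat set" and \<alpha>2 \<phi>2 l2 t2 h2 where
    f2: "filling P D2 \<alpha>2 \<phi>2 l2 t2 h2" "map l2 h2 = v"
    using assms(2) unfolding fillable_def by blast
  have "finite D1" "finite D2" using f1 f2 holed_diagramD(1) planar_mapD(1) by blast+
  then obtain f where f: "bij f" "D1 \<inter> f ` D2 = {}" by (rule exists_fresh_renaming)
  note r = filling_rename[OF f(1) f2(1)]
  show ?thesis
  proof (rule filling_union[OF f1(1) r(1) f(2)])
    fix \<phi>
    let ?l = "\<lambda>x. if x \<in> D1 then l1 x else (l2 \<circ> finv f) x"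
    let ?t = "\<lambda>x. if x \<in> D1 then t1 x else (t2 \<circ> finv f) x"
    assume new: "filling P (D1 \<union> f ` D2) (\<alpha>1 \<circ> (f \<circ> \<alpha>2 \<circ> finv f)) \<phi> ?l ?t (h1 @ map f h2)"
      and word: "map ?l (h1 @ map f h2) = map l1 h1 @ map (l2 \<circ> finv f) (map f h2)"
    show ?thesis by (rule fillableI[OF new]) (simp only: word r(2) f1(2) f2(2))
  qed
qed

text \<open>
  The map on the sphere with a single edge and two vertices.
\<close>

lemma fillable_edge: "fillable P [l, inv_letter l]"
proof -
  let ?D = "{0, 1 :: nat}" and ?t = "transpose 0 (1 :: nat)"
  have t: "?t permutes ?D" by (rule permutes_swap_id) auto
  have "planar ?D id ?t"
    by (simp add: planar_def euler_id)
  then have "planar ?D (id \<circ> ?t) ?t"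
  proof (intro planar_free_join)
    show "(0, 1) \<notin> equiv_cl (graph_of (id :: nat \<Rightarrow> nat))"
      using equiv_cl_invariant[of 0 1 "graph_of id" "\<lambda>x :: nat. x"] by auto
    show "(0, 1) \<in> equiv_cl (graph_of (?t \<circ> id))"
      using equiv_cl_graph_step(2)[of 0 ?t] by simp
  qed (use t in \<open>auto simp: permutes_id\<close>)
  then have "planar_map ?D ?t ?t" using t by (simp add: planar_map_def)
  then have "holed_diagram (rel_face P (\<lambda>_. undefined) (\<lambda>x. if x = 0 then l else inv_letter l)) ?D ?t ?t
      (\<lambda>x. if x = 0 then l else inv_letter l) [0, 1]"
    by (auto simp: holed_diagram_def cyc_def tiled_def)
  then show ?thesis by (rule fillableI) simp
qed

lemma fillable_insert_pair:
  assumes "fillable P (u @ v)"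
  shows "fillable P (u @ [l, inv_letter l] @ v)"
  using fillable_append[OF fillable_rotate[OF assms] fillable_edge[of P l]]
    fillable_rotate[of P v "u @ [l, inv_letter l]"]
  by simp

lemma fillable_remove_pair:
  assumes "fillable P (u @ [l, inv_letter l] @ v)"
  shows "fillable P (u @ v)"
proof -
  obtain D :: "nat set" and \<alpha> \<phi> lab tag h where
    f: "filling P D \<alpha> \<phi> lab tag h" "map lab h = u @ [l, inv_letter l] @ v"
    using assms unfolding fillable_def by blast
  then obtain hu a b hv where h: "h = hu @ [a, b] @ hv" "map lab hu = u" "map lab hv = v"
      "lab b = inv_letter (lab a)"
    by (auto simp: map_eq_append_conv map_eq_Cons_conv)
  have "filling P D \<alpha> \<phi> lab tag (hu @ [a, b] @ hv)" using f(1) h(1) by simp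
  then obtain \<alpha>' \<phi>' where "filling P (D - {a, b}) \<alpha>' \<phi>' lab tag (hu @ hv)"
    using h(4) by (rule holed_diagram_zip)
  then show ?thesis by (rule fillableI) (simp add: h)
qed

lemma fillable_insert_inverse_words:
  assumes "fillable P (u @ v)"
  shows "fillable P (u @ w @ inv_word w @ v)"
  using assms
proof (induction w arbitrary: u v)
  case (Cons l w)
  show ?case
    using Cons.IH[of "u @ [l]" "[inv_letter l] @ v"] fillable_insert_pair[OF Cons.prems, of l] by simp
qed simp

text \<open>
  The part of the hole that reads a relator or its inverse is cut off and becomes a 2-cell.
\<close>

lemma fillable_remove_relator:
  assumes fill: "fillable P (u @ w @ v)" and r: "r \<in> set (rels P)" "w = r \<or> w = inv_word r"
  shows "fillable P (u @ v)"
proof (cases "w = []")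
  case False
  have "fillable P ((v @ u) @ w)" using fillable_rotate[of P "u @ w" v] fill by simp
  then obtain D :: "nat set" and \<alpha> \<phi> lab tag h where
    f: "filling P D \<alpha> \<phi> lab tag h" "map lab h = (v @ u) @ w"
    unfolding fillable_def by blast
  then obtain k g where h: "h = k @ g" "map lab k = v @ u" "map lab g = w"
    by (metis map_eq_append_conv)
  note d = holed_diagramD[OF f(1)]
  have g: "g \<noteq> []" "distinct g" "set k \<inter> set g = {}" using h False d(6) by auto
  obtain i where i: "i < length (rels P)" "rels P ! i = r" using r(1) by (meson in_set_conv_nth)
  obtain b where b: "map (tag_letter P) (face_tags P i b) = w"
    using r(2) i face_tags_word[of P i] by metis
  then have "length g = length (face_tags P i b)" using h(3) by (metis length_map)
  then obtain tag' where tag': "map tag' g = face_tags P i b" "\<And>d. d \<notin> set g \<Longrightarrow> tag' d = tag d"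
    using exists_tagging[OF g(2)] by metis
  have "map (tag_letter P) (map tag' g) = map lab g" using b tag' h(3) by simp
  then have "\<forall>x\<in>set g. tag_letter P (tag' x) = lab x" by simp
  then have face: "rel_face P tag' lab g"
    using tag'(1) i(1) unfolding rel_face_def by metis
  obtain \<phi>' where pm: "planar_map D \<alpha> \<phi>'" and cyc: "cyc \<phi>' k" "cyc \<phi>' g"
    and \<phi>': "\<And>x. x \<notin> set h \<Longrightarrow> \<phi>' x = \<phi> x"
  proof (cases "k = []")
    case True
    then show ?thesis using that[of \<phi>] d h by simp
  next
    case False
    have "transpose (last k) (last g) x = x" if "x \<notin> set h" for x
      using that h(1) False g(1) by (intro transpose_apply_other) auto
    then show ?thesis
      using that[of "\<phi> \<circ> transpose (last k) (last g)"] False g(1) d(3,4) h(1)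
        planar_map_split_face[OF d(1), of k g] cyc_split[of \<phi> k g] by simp
  qed
  have "tiled (rel_face P tag' lab) \<phi>' (D - set h)"
    using d(5)
  proof (rule tiled_cong)
    show "\<phi> x = \<phi>' x" if "x \<in> D - set h" for x using that \<phi>' by simp
    show "rel_face P tag' lab fs" if "set fs \<subseteq> D - set h" "rel_face P tag lab fs" for fs
      by (rule rel_face_cong[OF _ _ that(2)]) (use that(1) tag'(2) h(1) in auto)
  qed
  then have "tiled (rel_face P tag' lab) \<phi>' ((D - set h) \<union> set g)"
    using tiled_face[of \<phi>' g] face cyc by (intro tiled_Un) auto
  also have "(D - set h) \<union> set g = D - set k" using h(1) g(3) d(3) by auto
  finally have "holed_diagram (rel_face P tag' lab) D \<alpha> \<phi>' lab k"
    using pm d(2,3) cyc h(1) by (auto simp: holed_diagram_def)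
  then have "fillable P (v @ u)" using h(2) unfolding fillable_def by blast
  then show ?thesis by (rule fillable_rotate)
qed (use fill in simp)

text \<open>
  Van Kampen's lemma. Stating it as an equivalence deals with the symmetry and transitivity of
  \<open>word_equiv\<close>. A relator is inserted by inserting \<open>r\<close> followed by its inverse, and by closing
  the inverse with a 2-cell.
\<close>

lemma fillable_word_equiv:
  assumes "word_equiv P u v"
  shows "fillable P u \<longleftrightarrow> fillable P v"
  using assms
proof induction
  case (cancel u v l)
  then show ?case using fillable_insert_pair fillable_remove_pair by blast
next
  case (relator u v r)
  show ?case
  proof
    assume "fillable P (u @ r @ v)"
    then show "fillable P (u @ v)" using fillable_remove_relator relator by blast
  next
    assume "fillable P (u @ v)"
    then have "fillable P ((u @ r) @ inv_word r @ v)"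
      using fillable_insert_inverse_words[of P u v r] by simp
    then show "fillable P (u @ r @ v)"
      using fillable_remove_relator[of P "u @ r" "inv_word r" v r] relator by simp
  qed
qed simp_all

section \<open>Closed fillings and spherical diagrams\<close>

lemma card_fixpoint_free_involution:
  assumes "finite K" "p permutes K" "\<And>d. d \<in> K \<Longrightarrow> p d \<noteq> d" "\<And>d. p (p d) = d"
  shows "card K = 2 * card (orbit p ` K)"
proof -
  have orb: "orbit p d = {d, p d}" for d
  proof -
    have "cyc p [d, p d] \<or> p d = d" using assms(4) by (auto simp: cyc_def)
    moreover have "inj p" using assms(2) by (rule permutes_inj)
    ultimately show ?thesis
      using equiv_cl_graph_orbit[OF assms(1,2), of d] cyc_class[of p "[d, p d]" d]
        orbit_eq_singleton_iff[of p d] by auto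
  qed
  have "card K = card (\<Union> (orbit p ` K))"
  proof -
    have "\<Union> (orbit p ` K) = K" using assms(2) by (auto simp: orb permutes_in_image)
    then show ?thesis by simp
  qed
  also have "\<dots> = 2 * card (orbit p ` K)"
  proof (rule card_partition[symmetric])
    show "finite (orbit p ` K)" "finite (\<Union> (orbit p ` K))" using assms(1) by (auto simp: orb)
    show "card c = 2" if "c \<in> orbit p ` K" for c
      using that assms(3) by (force simp: orb)
    show "c \<inter> c' = {}" if c: "c \<in> orbit p ` K" "c' \<in> orbit p ` K" "c \<noteq> c'" for c c'
    proof -
      obtain d d' where dd: "c = {d, p d}" "c' = {d', p d'}" using c(1,2) orb by auto
      have "c = c'" if "x \<in> c" "x \<in> c'" for x
        using that dd assms(4) by (metis insert_commute insert_iff singletonD)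
      then show ?thesis using c(3) by blast
    qed
  qed
  finally show ?thesis .
qed

text \<open>
  Reachability by directed steps coincides with connectedness, because a finite set that is mapped
  into itself by a permutation is mapped onto itself.
\<close>

lemma connected_planar_map_sphere:
  assumes pm: "planar_map K \<alpha> \<phi>" and ne: "K \<noteq> {}"
    and conn: "\<And>d d'. d \<in> K \<Longrightarrow> d' \<in> K \<Longrightarrow> (d, d') \<in> equiv_cl (graph_of \<alpha> \<union> graph_of \<phi>)"
  shows "spherical_map \<lparr>darts = K, flip = \<alpha>, face_next = \<phi>, cell = c, pos = p, orient = b\<rparr>"
proof -
  note pm' = planar_mapD[OF pm]
  let ?R = "{(a, b). a \<in> K \<and> (b = \<alpha> a \<or> b = \<phi> a)}"
  have reach: "(d, d') \<in> ?R\<^sup>*" if d: "d \<in> K" "d' \<in> K" for d d'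
  proof -
    define A where "A = {y \<in> K. (d, y) \<in> ?R\<^sup>*}"
    have A: "A \<subseteq> K" "\<alpha> ` A \<subseteq> A" "\<phi> ` A \<subseteq> A"
      using pm'(8,9) by (auto simp: A_def intro: rtrancl_into_rtrancl)
    have "(d \<in> A) = (d' \<in> A)"
      using conn[OF d]
    proof (rule equiv_cl_invariant)
      fix u v assume "(u, v) \<in> graph_of \<alpha> \<union> graph_of \<phi>"
      then show "(u \<in> A) = (v \<in> A)"
        using preimage_closed[OF pm'(1,2) A(1,2)] preimage_closed[OF pm'(1,3) A(1,3)] by auto
    qed
    then show ?thesis using d by (simp add: A_def)
  qed
  have "num_classes K (graph_of \<alpha> \<union> graph_of \<phi>) = 1"
  proof -
    obtain d where d: "d \<in> K" using ne by blast
    have "(\<lambda>x. equiv_cl (graph_of \<alpha> \<union> graph_of \<phi>) `` {x}) ` K =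
        (\<lambda>x. equiv_cl (graph_of \<alpha> \<union> graph_of \<phi>) `` {d}) ` K"
      by (rule image_cong) (simp_all add: equiv_cl_class_eq_iff conn d)
    also have "\<dots> = {equiv_cl (graph_of \<alpha> \<union> graph_of \<phi>) `` {d}}" using d by blast
    finally have "(\<lambda>x. equiv_cl (graph_of \<alpha> \<union> graph_of \<phi>) `` {x}) ` K =
        {equiv_cl (graph_of \<alpha> \<union> graph_of \<phi>) `` {d}}" .
    then show ?thesis by (simp add: num_classes_def)
  qed
  moreover have "\<phi> \<circ> \<alpha> permutes K" using pm'(2,3) by (rule permutes_compose)
  ultimately have "int (card (orbit \<alpha> ` K)) + int (card (orbit \<phi> ` K))
      + int (card (orbit (\<phi> \<circ> \<alpha>) ` K)) - 2 = int (card K)"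
    using pm'(6) num_classes_orbits[OF pm'(1)] pm'(2,3) by (simp add: planar_def euler_def)
  moreover have "card K = 2 * card (orbit \<alpha> ` K)"
    by (rule card_fixpoint_free_involution[OF pm'(1,2,4,5)])
  ultimately have euler: "card (orbit (\<phi> \<circ> \<alpha>) ` K) + card (orbit \<phi> ` K) = card (orbit \<alpha> ` K) + 2"
    by linarith
  show ?thesis
    unfolding spherical_map_def orbits_on_def diagram.select_convs
  proof (intro conjI ballI)
    show "(d, d') \<in> ?R\<^sup>*" if "d \<in> K" "d' \<in> K" for d d' by (rule reach[OF that])
    show "\<alpha> d \<noteq> d" if "d \<in> K" for d by (rule pm'(4)[OF that])
    show "\<alpha> (\<alpha> d) = d" for d by (rule pm'(5))
    show "finite K" by (rule pm'(1))
    show "\<alpha> permutes K" by (rule pm'(2))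
    show "\<phi> permutes K" by (rule pm'(3))
    show "card (orbit (\<phi> \<circ> \<alpha>) ` K) + card (orbit \<phi> ` K) = card (orbit \<alpha> ` K) + 2"
      by (rule euler)
  qed
qed

lemma face_positions:
  assumes face: "rel_face P tag lab fs" and cyc: "cyc p fs" and d: "d \<in> set fs"
    and tag: "\<And>x. x \<in> set fs \<Longrightarrow> tag x = (c x, q x, b x)"
  shows "c d < length (rels P)" "c (p d) = c d" "b (p d) = b d"
    "bij_betw q (set fs) {..<length (rels P ! c d)}"
    "if b d then q (p d) = (q d + 1) mod length (rels P ! c d)
      else q d = (q (p d) + 1) mod length (rels P ! c d)"
proof -
  obtain i b' where i: "i < length (rels P)" "map tag fs = face_tags P i b'"
    using face by (auto simp: rel_face_def)
  define n where "n = length (rels P ! i)"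
  have len: "length fs = n" 
    using arg_cong[OF i(2), of length] by (simp add: face_tags_def n_def split: if_splits)
  have nth: "c (fs ! j) = i" "b (fs ! j) = b'" "q (fs ! j) = (if b' then j else n - 1 - j)" if "j < n" for j
  proof -
    have "tag (fs ! j) = face_tags P i b' ! j" using that len i(2) by (metis nth_map)
    also have "\<dots> = (i, if b' then j else n - 1 - j, b')"
      using that by (auto simp: face_tags_def n_def rev_nth)
    finally show "c (fs ! j) = i" "b (fs ! j) = b'" "q (fs ! j) = (if b' then j else n - 1 - j)"
      using tag[of "fs ! j"] that len by auto
  qed
  obtain j where j: "j < n" "d = fs ! j" using d len by (metis in_set_conv_nth)
  have pd: "p d = fs ! (Suc j mod n)"
  proof -
    have "p d = map p fs ! j" using j len by simp
    also have "\<dots> = rotate1 fs ! j" using cyc by (simp add: cyc_def)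
    also have "\<dots> = fs ! (Suc j mod n)" using j len by (simp add: nth_rotate1)
    finally show ?thesis .
  qed
  have j': "Suc j mod n < n" using j by simp
  have "map q fs = (if b' then [0..<n] else rev [0..<n])"
  proof (rule nth_equalityI)
    fix k assume "k < length (map q fs)"
    then show "map q fs ! k = (if b' then [0..<n] else rev [0..<n]) ! k"
      using nth(3)[of k] len by (auto simp: rev_nth)
  qed (simp add: len)
  then have "distinct (map q fs)" "set (map q fs) = {..<n}" by auto
  then have "bij_betw q (set fs) {..<n}" by (simp add: bij_betw_def distinct_map)
  then show "bij_betw q (set fs) {..<length (rels P ! c d)}"
    using nth(1)[OF j(1)] j(2) by (simp add: n_def)
  show "c d < length (rels P)" "c (p d) = c d" "b (p d) = b d"
    using nth j j' pd i(1) by auto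
  have "if b' then q (p d) = (q d + 1) mod n else q d = (q (p d) + 1) mod n"
  proof (cases "Suc j = n")
    case True
    then show ?thesis using nth(3)[OF j(1)] nth(3)[OF j'] pd j by auto
  next
    case False
    then have "Suc j < n" using j by simp
    then show ?thesis using nth(3)[OF j(1)] nth(3)[OF j'] pd j by auto
  qed
  then show "if b d then q (p d) = (q d + 1) mod length (rels P ! c d)
      else q d = (q (p d) + 1) mod length (rels P ! c d)"
    using nth(1,2)[OF j(1)] j(2) by (simp only: n_def)
qed

text \<open>
  If there is no hole, the component of \<open>x\<close> is a spherical diagram, to which the hypothesis applies.
\<close>

lemma closed_filling_folding_edge:
  fixes D :: "nat set"
  assumes P: "finite_presentation P" and DR: "DR_all_directions P"
    and fill: "filling P D \<alpha> \<phi> lab tag []" and x: "x \<in> D"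
  obtains d where "d \<in> D" "fst (lab d) = fst (lab x)" "tag (\<alpha> d) = flip_tag (tag d)"
proof -
  note dd = holed_diagramD[OF fill]
  note pm = planar_mapD[OF dd(1)]
  define K where "K = equiv_cl (graph_of \<alpha> \<union> graph_of \<phi>) `` {x}"
  have closed: "\<alpha> ` K \<subseteq> K" "\<phi> ` K \<subseteq> K"
    unfolding K_def using equiv_cl_trans[OF _ equiv_cl_graph_step(1)[of _ \<alpha>]] equiv_cl_trans[OF _ equiv_cl_graph_step(3)[of _ \<phi>]]
    by blast+
  have KD: "K \<subseteq> D"
  proof
    fix y assume "y \<in> K"
    then have "(x \<in> D) = (y \<in> D)"
      unfolding K_def Image_singleton_iff by (rule equiv_cl_invariant) (auto simp: pm(8,9))
    then show "y \<in> D" using x by simp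
  qed
  have xK: "x \<in> K" by (simp add: K_def)
  let ?\<alpha> = "perm_restrict \<alpha> K" and ?\<phi> = "perm_restrict \<phi> K"
  have pmK: "planar_map K ?\<alpha> ?\<phi>" by (rule planar_map_restrict[OF dd(1) KD closed])
  note pmK' = planar_mapD[OF pmK]
  have tile: "tiled (rel_face P tag lab) ?\<phi> K"
    using tiled_closed_part[OF dd(5) closed(2)] KD by (simp add: Int_absorb1)
  let ?c = "\<lambda>d. fst (tag d)" and ?q = "\<lambda>d. fst (snd (tag d))" and ?b = "\<lambda>d. snd (snd (tag d))"
  define C where "C = \<lparr>darts = K, flip = ?\<alpha>, face_next = ?\<phi>, cell = ?c, pos = ?q, orient = ?b\<rparr>"
  have "darts C = K" by (simp add: C_def)
  have letter: "dart_letter P C d = lab d" if "d \<in> K" for d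
  proof -
    have "lab d = tag_letter P (tag d)"
      using tile that unfolding tiled_def rel_face_def by blast
    then show ?thesis
      by (cases "tag d") (simp add: C_def dart_letter_def tag_letter_def)
  qed
  have "spherical_map C"
    unfolding C_def
  proof (rule connected_planar_map_sphere[OF pmK])
    show "K \<noteq> {}" using xK by blast
    fix d d' assume d: "d \<in> K" "d' \<in> K"
    let ?E = "equiv_cl (graph_of ?\<alpha> \<union> graph_of ?\<phi>)"
    have "(x, y) \<in> ?E" if "y \<in> K" for y
    proof -
      have "(x \<in> K \<and> (x, x) \<in> ?E) = (y \<in> K \<and> (x, y) \<in> ?E)"
      proof (rule equiv_cl_invariant[of x y _ "\<lambda>z. z \<in> K \<and> (x, z) \<in> ?E"])
        show "(x, y) \<in> equiv_cl (graph_of \<alpha> \<union> graph_of \<phi>)" using that by (simp add: K_def)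
        fix u v assume uv: "(u, v) \<in> graph_of \<alpha> \<union> graph_of \<phi>"
        then have iff: "u \<in> K \<longleftrightarrow> v \<in> K"
          using preimage_closed[OF pm(1,2) KD closed(1)] preimage_closed[OF pm(1,3) KD closed(2)] by auto
        have "(u, v) \<in> ?E" if "u \<in> K"
          using uv that by (intro equiv_cl_base) (auto simp: perm_restrict_def)
        then show "(u \<in> K \<and> (x, u) \<in> ?E) = (v \<in> K \<and> (x, v) \<in> ?E)"
          using iff by (meson equiv_cl_sym equiv_cl_trans)
      qed
      then show ?thesis using xK by simp
    qed
    then show "(d, d') \<in> ?E" using d by (meson equiv_cl_sym equiv_cl_trans)
  qed
  moreover have "let d' = face_next C d; n = length (rels P ! cell C d) in
        cell C d < length (rels P) \<and> cell C d' = cell C d \<and> orient C d' = orient C d \<and>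
        bij_betw (pos C) (orbit (face_next C) d) {..<n} \<and>
        (if orient C d then pos C d' = (pos C d + 1) mod n else pos C d = (pos C d' + 1) mod n) \<and>
        dart_letter P C (flip C d) = inv_letter (dart_letter P C d)" if d: "d \<in> K" for d
  proof -
    obtain fs where fs: "d \<in> set fs" "cyc ?\<phi> fs" "rel_face P tag lab fs"
      using tile d unfolding tiled_def by blast
    have "orbit ?\<phi> d = set fs"
      using equiv_cl_graph_orbit[OF pmK'(1,3)] cyc_class[OF pmK'(10) fs(2,1)] by simp
    moreover have "lab (?\<alpha> d) = inv_letter (lab d)" "?\<alpha> d \<in> K"
      using d dd(2) KD closed(1) by (auto simp: perm_restrict_simps)
    ultimately show ?thesis
      using face_positions[OF fs(3,2,1), of ?c ?q ?b] letter d by (simp add: C_def Let_def)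
  qed
  ultimately have sph: "spherical_diagram P C"
    unfolding spherical_diagram_def \<open>darts C = K\<close> by blast
  have "fst (lab x) \<in> gens P"
  proof -
    obtain fs where fs: "x \<in> set fs" "rel_face P tag lab fs"
      using tile xK unfolding tiled_def by blast
    then obtain r where "r \<in> set (rels P)" "map lab fs = r \<or> map lab fs = inv_word r"
      using rel_face_word by blast
    then have "map lab fs \<in> words_over (gens P)"
      using P unfolding finite_presentation_def by (auto simp: words_over_inv_word)
    then have "lab x \<in> gens P \<times> UNIV" using fs(1) by (auto simp: words_over_def)
    then show ?thesis by (simp add: mem_Times_iff)
  qed
  then obtain d where d: "d \<in> K" "edge_label P C d = fst (lab x)" "folding_edge C d"
    using DR sph xK letter[OF xK] unfolding DR_all_directions_def
    by (fastforce simp: C_def edge_label_def)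
  have "tag (\<alpha> d) = flip_tag (tag d)"
    using d by (cases "tag d"; cases "tag (\<alpha> d)")
      (simp add: folding_edge_def C_def flip_tag_def perm_restrict_simps)
  then show ?thesis using that[of d] d KD letter by (auto simp: edge_label_def)
qed

section \<open>Minimal fillings\<close>

text \<open>
  The faces at a folding edge have the same relator and opposite orientations, so the tags of one are
  the reversed and flipped tags of the other. As the tags on a face are distinct, the lists
  can be compared from the folding edge onwards, and this gives the inverse labels that
  \<open>holed_diagram_fold\<close> asks for.
\<close>

lemma filling_fold:
  assumes fill: "filling P D \<alpha> \<phi> lab tag h"
    and d: "d \<in> D - set h" "\<alpha> d \<in> D - set h" and fold: "tag (\<alpha> d) = flip_tag (tag d)"
  obtains D' \<alpha>' \<phi>' where "D' \<subset> D" "filling P D' \<alpha>' \<phi>' lab tag h"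
proof -
  note dd = holed_diagramD[OF fill]
  have inj: "inj \<phi>" using planar_mapD[OF dd(1)] by simp
  let ?e = "\<alpha> d"
  obtain fs where fs: "d \<in> set fs" "set fs \<subseteq> D - set h" "cyc \<phi> fs" "rel_face P tag lab fs"
    using dd(5) d(1) unfolding tiled_def by blast
  obtain gs where gs: "?e \<in> set gs" "set gs \<subseteq> D - set h" "cyc \<phi> gs" "rel_face P tag lab gs"
    using dd(5) d(2) unfolding tiled_def by blast
  obtain i b where i: "map tag fs = face_tags P i b" using fs(4) by (auto simp: rel_face_def)
  obtain i' b' where i': "map tag gs = face_tags P i' b'" using gs(4) by (auto simp: rel_face_def)
  have comp: "fst t = i \<and> snd (snd t) = b" if "t \<in> set (face_tags P i b)" for t i b
    using that by (auto simp: face_tags_def)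
  have tagf: "fst (tag x) = i \<and> snd (snd (tag x)) = b" if "x \<in> set fs" for x
    using comp[of "tag x" i b] that i by (metis image_eqI set_map)
  have tagg: "fst (tag x) = i' \<and> snd (snd (tag x)) = b'" if "x \<in> set gs" for x
    using comp[of "tag x" i' b'] that i' by (metis image_eqI set_map)
  have ib': "i' = i" "b' = (\<not> b)"
    using tagf[OF fs(1)] tagg[OF gs(1)] fold by (auto simp: flip_tag_def split: prod.splits)
  have disj: "set fs \<inter> set gs = {}"
    using tagf tagg ib' by (metis disjoint_iff)
  obtain p1 q1 where f: "fs = p1 @ d # q1" using fs(1) by (meson split_list)
  obtain p2 q2 where g: "gs = p2 @ ?e # q2" using gs(1) by (meson split_list)
  let ?m = "\<lambda>xs. rev (map flip_tag (map tag xs))"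
  have "map tag gs = ?m fs" using i i' ib' face_tags_flip[of P i b] by simp
  then have eq: "map tag p2 @ flip_tag (tag d) # map tag q2 = ?m q1 @ flip_tag (tag d) # ?m p1"
    using fold by (simp add: f g)
  moreover have "distinct (map tag p2 @ flip_tag (tag d) # map tag q2)"
    using i' distinct_face_tags[of P i' b'] fold by (simp add: g flip: i')
  ultimately have "map tag p2 = ?m q1 \<and> map tag q2 = ?m p1"
    by (subst (asm) append_Cons_eq_iff) auto
  then have tags: "map tag (q2 @ p2) = ?m (q1 @ p1)" by simp
  have lab: "lab x = tag_letter P (tag x)" if "x \<in> set fs \<union> set gs" for x
    using that fs(4) gs(4) by (auto simp: rel_face_def)
  have "map lab (q2 @ p2) = map (tag_letter P) (map tag (q2 @ p2))"
    using lab by (auto simp: g)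
  also have "\<dots> = rev (map inv_letter (map (tag_letter P) (map tag (q1 @ p1))))"
    unfolding tags by (simp add: rev_map comp_def)
  also have "map (tag_letter P) (map tag (q1 @ p1)) = map lab (q1 @ p1)"
    using lab by (auto simp: f)
  finally have lab_es: "map lab (q2 @ p2) = inv_word (map lab (q1 @ p1))" by (simp add: inv_word_def)
  have cyc: "cyc \<phi> ((q1 @ p1) @ [d])" "cyc \<phi> (?e # (q2 @ p2))"
    using cyc_rotate[of \<phi> "p1 @ [d]" q1] cyc_rotate[of \<phi> p2 "?e # q2"] fs(3) gs(3) by (simp_all add: f g)
  have sets: "set ((q1 @ p1) @ [d]) = set fs" "set (?e # (q2 @ p2)) = set gs" by (auto simp: f g)
  obtain \<alpha>' \<phi>' where "filling P (D - set ((q1 @ p1) @ [d]) - set (?e # (q2 @ p2))) \<alpha>' \<phi>' lab tag h"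
    by (rule holed_diagram_fold[OF fill _ cyc _ _ _ lab_es]) (use d(1) disj fs(2) gs(2) sets in auto)
  moreover have "D - set ((q1 @ p1) @ [d]) - set (?e # (q2 @ p2)) \<subset> D" using d(1) by auto
  ultimately show ?thesis using that by blast
qed

lemma letters_over: "map l h \<in> words_over S \<Longrightarrow> y \<in> set h \<Longrightarrow> fst (l y) \<in> S"
  by (induction h) auto

text \<open>
  Doubling. The filling and its mirror image have boundary words \<open>w\<close> and \<open>w\<^sup>-\<^sup>1\<close>, so their union along
  the hole can be zipped up to a closed filling. Zipping affects \<open>\<alpha>\<close> only at darts with labels from \<open>w\<close>, hence from
  \<open>S\<close>, so a folding edge with a label outside \<open>S\<close> was there before, in one of the two halves.
\<close>

lemma minimal_filling_labels:
  fixes D :: "nat set"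
  assumes P: "finite_presentation P" and DR: "DR_all_directions P"
    and fill: "filling P D \<alpha> \<phi> lab tag h" and S: "map lab h \<in> words_over S"
    and minimal: "\<And>(D' :: nat set) \<alpha>' \<phi>' lab' tag' h'. filling P D' \<alpha>' \<phi>' lab' tag' h' \<Longrightarrow>
      map lab' h' = map lab h \<Longrightarrow> card D \<le> card D'"
    and x: "x \<in> D"
  shows "fst (lab x) \<in> S"
proof (rule ccontr)
  assume xS: "fst (lab x) \<notin> S"
  have fin: "finite D" using fill holed_diagramD(1) planar_mapD(1) by blast
  obtain f where f: "bij f" "D \<inter> f ` D = {}" using exists_fresh_renaming[OF fin fin] .
  note m = filling_mirror[OF fill]
  let ?D2 = "f ` D" and ?\<alpha>2 = "f \<circ> \<alpha> \<circ> finv f" and ?\<phi>2 = "f \<circ> finv \<phi> \<circ> finv f"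
    and ?l2 = "inv_letter \<circ> lab \<circ> finv f" and ?t2 = "flip_tag \<circ> tag \<circ> finv f" and ?h2 = "map f (rev h)"
  have fill2: "filling P ?D2 ?\<alpha>2 ?\<phi>2 ?l2 ?t2 ?h2" and word2: "map ?l2 ?h2 = inv_word (map lab h)"
    using filling_rename[OF f(1) m(1)] m(2) by simp_all
  define l where "l = (\<lambda>x. if x \<in> D then lab x else ?l2 x)"
  define t where "t = (\<lambda>x. if x \<in> D then tag x else ?t2 x)"
  show False
  proof (rule filling_union[OF fill fill2 f(2), folded l_def t_def])
    fix \<phi>0
    assume dbl: "filling P (D \<union> ?D2) (\<alpha> \<circ> ?\<alpha>2) \<phi>0 l t (h @ ?h2)"
      and words: "map l (h @ ?h2) = map lab h @ map ?l2 ?h2"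
      and \<alpha>0: "\<And>x. x \<in> D \<Longrightarrow> (\<alpha> \<circ> ?\<alpha>2) x = \<alpha> x"
        "\<And>x. x \<in> ?D2 \<Longrightarrow> (\<alpha> \<circ> ?\<alpha>2) x = ?\<alpha>2 x"
    have "map l h = map lab h \<and> map l ?h2 = map ?l2 ?h2"
      using words append_eq_append_conv[of "map l h" "map lab h" "map l ?h2" "map ?l2 ?h2"]
      by (simp only: map_append length_map simp_thms)
    then have wl: "map l h = map lab h" "map l ?h2 = inv_word (map l h)"
      using word2 by argo+
    have hole_S: "fst (l y) \<in> S" if "y \<in> set h" for y
      using letters_over[of l h S y] S wl(1) that by simp
    have hole2_S: "fst (l y) \<in> S" if "y \<in> set ?h2" for y
    proof -
      have "map l ?h2 \<in> words_over S" using S wl by (simp only: words_over_inv_word)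
      then show ?thesis using that by (rule letters_over)
    qed
    let ?N = "D \<union> ?D2 - set h - set ?h2"
    obtain \<alpha>' \<phi>' where clo: "filling P ?N \<alpha>' \<phi>' l t []"
      and \<alpha>': "\<And>x. x \<in> ?N \<Longrightarrow> fst (l x) \<notin> (fst \<circ> l) ` set h \<Longrightarrow> \<alpha>' x = (\<alpha> \<circ> ?\<alpha>2) x"
      using holed_diagram_zip_all[of _ _ _ _ l "[]" h ?h2 "[]"] dbl wl(2) by (metis append_Nil append_Nil2)
    have lx: "l x = lab x" using x by (simp add: l_def)
    have "x \<in> ?N"
      using x xS lx hole_S hole2_S by (metis Diff_iff UnI1)
    then obtain d where d: "d \<in> ?N" "fst (l d) = fst (l x)" "t (\<alpha>' d) = flip_tag (t d)"
      using closed_filling_folding_edge[OF P DR clo] by metis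
    have dS: "fst (l d) \<notin> S" using d(2) lx xS by simp
    have "fst (l d) \<notin> (fst \<circ> l) ` set h" using dS hole_S by auto
    then have \<alpha>d: "\<alpha>' d = (\<alpha> \<circ> ?\<alpha>2) d" using \<alpha>' d(1) by blast
    have lab\<alpha>: "fst (l ((\<alpha> \<circ> ?\<alpha>2) d)) = fst (l d)"
      using holed_diagramD(2)[OF dbl, of d] d(1) by simp
    then have \<alpha>N: "(\<alpha> \<circ> ?\<alpha>2) d \<notin> set h" "(\<alpha> \<circ> ?\<alpha>2) d \<notin> set ?h2"
      using dS hole_S hole2_S by metis+
    have card2: "card ?D2 = card D" using f(1) by (meson bij_is_inj card_image inj_on_subset subset_UNIV)
    show False
    proof (cases "d \<in> D")
      case True
      have "\<alpha> d \<in> D" using True planar_mapD(8)[OF holed_diagramD(1)[OF fill]] by simp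
      then have "tag (\<alpha> d) = flip_tag (tag d)"
        using d(3) True \<alpha>d \<alpha>0(1) by (simp add: t_def)
      then obtain D' \<alpha>1 \<phi>1 where D': "D' \<subset> D" "filling P D' \<alpha>1 \<phi>1 lab tag h"
        using filling_fold[OF fill, of d] True d(1) \<alpha>N(1) \<alpha>0(1)[OF True] \<open>\<alpha> d \<in> D\<close>
        by (metis Diff_iff)
      then show False using minimal[OF D'(2)] fin psubset_card_mono[of D D'] by simp
    next
      case False
      then have d2: "d \<in> ?D2" using d(1) by blast
      then have a2: "?\<alpha>2 d \<in> ?D2" using planar_mapD(8)[OF holed_diagramD(1)[OF fill2]] by blast
      then have "?\<alpha>2 d \<notin> D" using f(2) by blast
      then have "?t2 (?\<alpha>2 d) = flip_tag (?t2 d)"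
        using d(3) False \<alpha>d \<alpha>0(2)[OF d2] by (simp add: t_def)
      then obtain D' \<alpha>1 \<phi>1 where D': "D' \<subset> ?D2" "filling P D' \<alpha>1 \<phi>1 ?l2 ?t2 ?h2"
        using filling_fold[OF fill2, of d] d2 a2 d(1) \<alpha>N(2) \<alpha>0(2)[OF d2] by (metis Diff_iff)
      have "map (inv_letter \<circ> ?l2) (rev ?h2) = map lab h"
        using filling_mirror(2)[OF D'(2)] word2 by simp
      then have "card D \<le> card D'" using minimal filling_mirror(1)[OF D'(2)] by blast
      then show False using D'(1) card2 fin psubset_card_mono[of ?D2 D'] by simp
    qed
  qed
qed

section \<open>From fillings back to words\<close>

lemma word_equiv_cyclic:
  assumes P: "finite_presentation P" and uv: "word_equiv P (u @ v) []"
  shows "word_equiv P (v @ u) []"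
proof -
  have words: "u \<in> words_over (gens P)" "v \<in> words_over (gens P)"
    using word_equiv_words[OF P uv] by auto
  let ?w = "inv_word u"
  have w: "?w \<in> words_over (gens P)" "word_equiv P (?w @ u) []"
    using word_equiv_inverse[OF P words(1)] by (auto simp: inv_word_def)
  have "word_equiv P (?w @ (u @ v) @ u) (?w @ [] @ u)"
    by (rule word_equiv_context[OF uv w(1) words(1) P])
  moreover have "word_equiv P ((?w @ u) @ (v @ u)) ([] @ (v @ u))"
    using words by (intro word_equiv_append[OF P w(2)] word_equiv.refl) simp
  ultimately show ?thesis using w(2) by (simp) (meson word_equiv.sym word_equiv.trans)
qed

lemma word_equiv_face:
  assumes P: "finite_presentation P" and r: "r \<in> set (rels P)" "w = r \<or> w = inv_word r"
  shows "word_equiv P w []"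
proof -
  have words: "r \<in> words_over (gens P)" using P r(1) by (auto simp: finite_presentation_def)
  have r1: "word_equiv P r []"
    using word_equiv.relator[of "[]" P "[]" r] r(1) by simp
  have "word_equiv P (inv_word r @ r) []"
    using word_equiv_inverse[OF P words] by (simp add: inv_word_def)
  moreover have "word_equiv P (inv_word r @ r) (inv_word r @ [])"
    using words by (intro word_equiv_append[OF P _ r1] word_equiv.refl) simp
  ultimately have "word_equiv P (inv_word r) []"
    by simp (meson word_equiv.sym word_equiv.trans)
  then show ?thesis using r(2) r1 by blast
qed

text \<open>
  The converse half of van Kampen's lemma, by induction on the number of darts. Consider the edge of the
  first dart \<open>d\<close> of the hole. If the hole lies on both sides, its boundary word is \<open>d u d\<^sup>-\<^sup>1 v\<close>, and
  cutting at this edge separates a filling of \<open>u\<close> from a filling of \<open>d d\<^sup>-\<^sup>1 v\<close>; if \<open>u\<close> is empty the edge is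
  just zipped up. If there is a 2-cell on the other side, removing the edge merges this 2-cell into the hole, and
  the letter of \<open>d\<close> is replaced by the inverse of the rest of the boundary of the 2-cell.
\<close>

lemma filling_word_trivial:
  fixes D :: "'d set"
  assumes P: "finite_presentation P" and S: "S \<subseteq> gens P"
    and fill: "filling P D \<alpha> \<phi> lab tag h" and labels: "\<And>d. d \<in> D \<Longrightarrow> fst (lab d) \<in> S"
  shows "word_equiv (sub_presentation P S) (map lab h) []"
  using fill labels
proof (induction "card D" arbitrary: D \<alpha> \<phi> h rule: less_induct)
  case less
  let ?P = "sub_presentation P S"
  note fin = finite_sub_presentation[OF P S]
  have gens: "gens ?P = S" by (simp add: sub_presentation_def)
  note dd = holed_diagramD[OF less.prems(1)]
  note pm = planar_mapD[OF dd(1)]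
  have word: "map lab xs \<in> words_over (gens ?P)" if "set xs \<subseteq> D" for xs
    using that less.prems(2) by (induction xs) (auto simp: gens)
  show ?case
  proof (cases h)
    case Nil
    then show ?thesis by (simp add: word_equiv.refl)
  next
    case (Cons d k)
    define e where "e = \<alpha> d"
    have d: "d \<in> D" using dd(3) Cons by simp
    have e: "e \<in> D" "e \<noteq> d" "lab e = inv_letter (lab d)" using d pm(4,8) dd(2) by (auto simp: e_def)
    show ?thesis
    proof (cases "e \<in> set k")
      case True
      then obtain u v where k: "k = u @ e # v" by (meson split_list)
      have hole: "cyc \<phi> (u @ (e # v @ [d]))"
        using cyc_rotate[of \<phi> "[d]" k] dd(4) Cons k by simp
      have words: "map lab u \<in> words_over (gens ?P)" "map lab v \<in> words_over (gens ?P)"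
          "fst (lab d) \<in> gens ?P"
        using word[of u] word[of v] word[of "[d]"] dd(3) Cons k by auto
      have cancel: "word_equiv ?P ([lab d, inv_letter (lab d)] @ map lab v) (map lab v)"
        using word_equiv.cancel[of "[]" ?P "map lab v" "lab d"] words by simp
      have pieces: "word_equiv ?P (map lab u) [] \<and>
        word_equiv ?P ([lab d, inv_letter (lab d)] @ map lab v) []"
      proof (cases "u = []")
        case True
        have "filling P D \<alpha> \<phi> lab tag ([] @ [d, e] @ v)" using less.prems(1) Cons k True by simp
        then obtain \<alpha>' \<phi>' where new: "filling P (D - {d, e}) \<alpha>' \<phi>' lab tag ([] @ v)"
          using e(3) by (rule holed_diagram_zip)
        have "card (D - {d, e}) < card D" using d pm(1) by (intro psubset_card_mono) auto
        then have "word_equiv ?P (map lab v) []"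
          using less.hyps[OF _ new] less.prems(2) by simp
        then show ?thesis using True cancel by (auto intro: word_equiv.refl word_equiv.trans)
      next
        case False
        let ?x = "last u"
        let ?\<phi> = "\<phi> \<circ> transpose ?x d"
        have x: "?x \<in> set u" using False by simp
        have sub: "set u \<subseteq> D" "set (e # v @ [d]) \<subseteq> D" using dd(3) Cons k by auto
        have xd: "?x \<noteq> d" using x hole by (auto simp: cyc_def)
        have cyc: "cyc ?\<phi> u" "cyc ?\<phi> (e # v @ [d])"
          using cyc_split[OF hole False] by simp_all
        have pm': "planar_map D \<alpha> ?\<phi>"
          using planar_map_split_face[OF dd(1) hole] sub False by simp
        note pm'' = planar_mapD[OF pm']
        \<comment> \<open>The vertex splits together with the face, as \<open>\<alpha> \<circ> \<phi>\<close> sends the last dart of \<open>u\<close> to \<open>d\<close>.\<close>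
        have sep: "(?x, d) \<notin> equiv_cl (graph_of ?\<phi> \<union> graph_of \<alpha>)"
        proof (rule planar_split_separates[OF pm(1,3,2) _ d xd pm(7)])
          show "?x \<in> D" using x sub by blast
          show "(?x, d) \<in> equiv_cl (graph_of \<phi>)"
            using x by (intro cyc_connected[OF hole]) auto
          have "\<phi> ?x = e"
          proof -
            have "cyc \<phi> ((butlast u @ [?x]) @ (e # v @ [d]))"
              using hole by (simp only: append_butlast_last_id[OF False])
            then have "cyc \<phi> (butlast u @ [?x] @ (e # v) @ [d])"
              by (simp only: append_assoc append_Cons append_Nil)
            then show ?thesis unfolding cyc_snoc_split by simp
          qed
          then have "(\<alpha> \<circ> \<phi>) ?x = d" using pm(5)[of d] by (simp add: e_def)
          then show "(?x, d) \<in> equiv_cl (graph_of (\<alpha> \<circ> \<phi>))"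
            using equiv_cl_graph_step(2)[of ?x "\<alpha> \<circ> \<phi>"] by metis
        qed
        define K where "K = equiv_cl (graph_of ?\<phi> \<union> graph_of \<alpha>) `` {?x}"
        have closed: "\<alpha> ` K \<subseteq> K" "?\<phi> ` K \<subseteq> K"
          unfolding K_def using equiv_cl_trans[OF _ equiv_cl_graph_step(3)[of _ \<alpha>]] equiv_cl_trans[OF _ equiv_cl_graph_step(1)[of _ ?\<phi>]]
          by blast+
        have KD: "K \<subseteq> D"
        proof
          fix y assume "y \<in> K"
          then have "(?x, y) \<in> equiv_cl (graph_of ?\<phi> \<union> graph_of \<alpha>)" by (simp add: K_def)
          then have "(?x \<in> D) = (y \<in> D)"
            by (rule equiv_cl_invariant) (use pm''(8,9) in auto)
          then show "y \<in> D" using x sub by blast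
        qed
        have uK: "set u \<subseteq> K"
          using cyc_subset_closed[OF cyc(1) x _ closed(2)] by (simp add: K_def)
        have dK: "d \<notin> K" using sep by (simp add: K_def)
        have co: "\<alpha> ` (D - K) \<subseteq> D - K" "?\<phi> ` (D - K) \<subseteq> D - K"
          using preimage_closed[OF pm''(1,2) KD closed(1)] preimage_closed[OF pm''(1,3) KD closed(2)]
            pm''(8,9) by blast+
        have dvK: "set (e # v @ [d]) \<subseteq> D - K"
          by (rule cyc_subset_closed[OF cyc(2) _ _ co(2)]) (use d dK in auto)
        have rest: "tiled (rel_face P tag lab) ?\<phi> (D - set h)"
          using dd(5)
        proof (rule tiled_cong)
          fix y assume "y \<in> D - set h"
          then have "transpose ?x d y = y"
            using x Cons k by (intro transpose_apply_other) auto
          then show "\<phi> y = ?\<phi> y" by simp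
        qed
        have piece: "word_equiv ?P (map lab g) []"
          if L: "L \<subset> D" "\<alpha> ` L \<subseteq> L" "?\<phi> ` L \<subseteq> L" and g: "set g = set h \<inter> L" "cyc ?\<phi> g" for L g
        proof -
          let ?\<alpha>L = "perm_restrict \<alpha> L" and ?\<phi>L = "perm_restrict ?\<phi> L"
          have "tiled (rel_face P tag lab) ?\<phi>L ((D - set h) \<inter> L)"
            by (rule tiled_closed_part[OF rest L(3)])
          moreover have "(D - set h) \<inter> L = L - set g" using L(1) g(1) by auto
          moreover have "cyc ?\<phi>L g"
            using g(2) by (rule cyc_congI) (use g(1) in \<open>auto simp: perm_restrict_simps\<close>)
          moreover have "lab (?\<alpha>L y) = inv_letter (lab y)" if "y \<in> L" for y
            using that L(1) dd(2) by (auto simp: perm_restrict_simps)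
          ultimately have "filling P L ?\<alpha>L ?\<phi>L lab tag g"
            using planar_map_restrict[OF pm' _ L(2,3)] L(1) g(1) by (auto simp: holed_diagram_def)
          moreover have "card L < card D" using L(1) pm(1) by (rule psubset_card_mono[rotated])
          ultimately show ?thesis
            using less.hyps[of L] less.prems(2) L(1) by blast
        qed
        have hset: "set h = set u \<union> set (e # v @ [d])" using Cons k by auto
        have "word_equiv ?P (map lab u) []"
        proof (rule piece[OF _ closed])
          show "K \<subset> D" using KD d dK by blast
          show "set u = set h \<inter> K" using hset uK dvK by blast
        qed (rule cyc)
        moreover have "word_equiv ?P (map lab ([d] @ e # v)) []"
        proof (rule piece[OF _ co])
          show "D - K \<subset> D" using x uK sub by blast
          show "set ([d] @ e # v) = set h \<inter> (D - K)" using hset uK dvK by auto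
          show "cyc ?\<phi> ([d] @ e # v)" using cyc_rotate[of ?\<phi> "e # v" "[d]"] cyc(2) by simp
        qed
        ultimately show ?thesis using e(3) by simp
      qed
      have "word_equiv ?P (([lab d] @ map lab u @ [inv_letter (lab d)]) @ map lab v)
          (([lab d] @ [] @ [inv_letter (lab d)]) @ map lab v)"
        using words pieces
        by (intro word_equiv_append[OF fin] word_equiv_context[OF _ _ _ fin] word_equiv.refl) auto
      then show ?thesis using pieces Cons k e(3) by (auto intro: word_equiv.trans)
    next
      case False
      have eD: "e \<in> D - set h" using False e Cons by simp
      then obtain fs where fs: "e \<in> set fs" "set fs \<subseteq> D - set h" "cyc \<phi> fs" "rel_face P tag lab fs"
        using dd(5) unfolding tiled_def by blast
      then obtain p q where f: "fs = p @ e # q" by (meson split_list)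
      let ?es = "q @ p"
      have cyc: "cyc \<phi> (k @ [d])" "cyc \<phi> (\<alpha> d # ?es)"
        using cyc_rotate[of \<phi> "[d]" k] dd(4) Cons cyc_rotate[of \<phi> p "e # q"] fs(3) f
        by (simp_all add: e_def)
      have disj: "set (k @ [d]) \<inter> set (\<alpha> d # ?es) = {}" and es: "set ?es \<subseteq> D"
        using fs(2) f Cons by (auto simp: e_def)
      let ?\<phi> = "\<phi> \<circ> transpose d (last (\<alpha> d # ?es))"
      note j = planar_map_join_across[OF dd(1) cyc d disj es]
      have "tiled (rel_face P tag lab) ?\<phi> (D - set h - set fs)"
        using tiled_remove_face[OF pm(10) dd(5) fs(3)]
      proof (rule tiled_cong)
        fix y assume y: "y \<in> D - set h - set fs"
        have "last (\<alpha> d # ?es) \<in> set fs" using last_in_set[of "\<alpha> d # ?es"] f by (auto simp: e_def)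
        then have "transpose d (last (\<alpha> d # ?es)) y = y"
          using y Cons by (intro transpose_apply_other) auto
        then show "\<phi> y = ?\<phi> y" by simp
      qed
      moreover have "D - set h - set fs = D - set (k @ [d, e] @ ?es)" using Cons f by auto
      ultimately have "filling P D \<alpha> ?\<phi> lab tag (k @ [d, e] @ ?es)"
        using j dd(2,3) Cons d e(1) es unfolding holed_diagram_def by (auto simp: e_def)
      then obtain \<alpha>' \<phi>' where new: "filling P (D - {d, e}) \<alpha>' \<phi>' lab tag (k @ ?es)"
        using e(3) by (rule holed_diagram_zip)
      have "card (D - {d, e}) < card D" using d pm(1) by (intro psubset_card_mono) auto
      then have IH: "word_equiv ?P (map lab (k @ ?es)) []"
        using less.hyps[OF _ new] less.prems(2) by simp
      have fsw: "map lab fs \<in> words_over S" using word[of fs] fs(2) by (simp add: gens) blast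
      obtain r where r: "r \<in> set (rels P)" "map lab fs = r \<or> map lab fs = inv_word r"
        using rel_face_word[OF fs(4)] by blast
      then have "r \<in> set (rels ?P)" using fsw by (auto simp: sub_presentation_def)
      then have "word_equiv ?P (map lab fs) []" using r(2) by (rule word_equiv_face[OF fin])
      then have "word_equiv ?P (map lab (e # ?es)) []"
        using word_equiv_cyclic[OF fin, of "map lab p" "map lab (e # q)"] f by simp
      then have face: "word_equiv ?P (inv_letter (lab d) # map lab ?es) []" using e(3) by simp
      have words: "map lab k \<in> words_over (gens ?P)" "map lab ?es \<in> words_over (gens ?P)"
          "fst (lab d) \<in> gens ?P"
        using word[of k] word[of ?es] word[of "[d]"] dd(3) Cons es d by auto
      have "word_equiv ?P (map lab (k @ [d])) []"
      proof -
        have 1: "word_equiv ?P (map lab (k @ [d]) @ (inv_letter (lab d) # map lab ?es)) (map lab (k @ [d]) @ [])"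
          using words by (intro word_equiv_append[OF fin _ face] word_equiv.refl) simp
        have 2: "word_equiv ?P (map lab k @ [lab d, inv_letter (lab d)] @ map lab ?es) (map lab k @ map lab ?es)"
          by (rule word_equiv.cancel[OF words])
        show ?thesis using 1 2 IH by simp (meson word_equiv.sym word_equiv.trans)
      qed
      then show ?thesis using word_equiv_cyclic[OF fin, of "map lab k" "[lab d]"] Cons by simp
    qed
  qed
qed

lemma trivial_word_in_sub_presentation:
  assumes P: "finite_presentation P" and DR: "DR_all_directions P" and S: "S \<subseteq> gens P"
    and w: "w \<in> words_over S" and triv: "word_equiv P w []"
  shows "word_equiv (sub_presentation P S) w []"
proof -
  define size where "size n \<longleftrightarrow> (\<exists>(D :: nat set) \<alpha> \<phi> lab tag h.
    filling P D \<alpha> \<phi> lab tag h \<and> map lab h = w \<and> card D = n)" for n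
  have "fillable P w" using fillable_word_equiv[OF triv] fillable_Nil by blast
  then have "\<exists>n. size n" unfolding fillable_def size_def by blast
  then have least: "size (Least size)" by (rule LeastI_ex)
  then obtain D :: "nat set" and \<alpha> \<phi> lab tag h where
    D: "filling P D \<alpha> \<phi> lab tag h" "map lab h = w" "card D = Least size"
    unfolding size_def by blast
  have "fst (lab x) \<in> S" if "x \<in> D" for x
  proof (rule minimal_filling_labels[OF P DR D(1) _ _ that])
    show "map lab h \<in> words_over S" using D(2) w by simp
    fix D' :: "nat set" and \<alpha>' \<phi>' lab' tag' h'
    assume "filling P D' \<alpha>' \<phi>' lab' tag' h'" "map lab' h' = map lab h"
    then have "size (card D')" using D(2) unfolding size_def by blast
    then show "card D \<le> card D'" unfolding D(3) by (rule Least_le)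
  qed
  then show ?thesis using filling_word_trivial[OF P S D(1)] D(2) by simp
qed

theorem theorem2p3:
  fixes P :: "'a presentation"
  assumes "finite_presentation P"
    and "DR_all_directions P"
  shows "\<forall>S. S \<subseteq> gens P \<longrightarrow>
    inclusion_map P \<in> mon (presented_group (sub_presentation P S)) (presented_group P)"
proof (intro allI impI)
  fix S assume S: "S \<subseteq> gens P"
  let ?P = "sub_presentation P S"
  note P = assms(1) and fin = finite_sub_presentation[OF assms(1) S]
  have gens: "gens ?P = S" by (simp add: sub_presentation_def)
  have one: "\<one>\<^bsub>presented_group R\<^esub> = word_rel R `` {[]}" for R :: "'a presentation"
    by (simp add: presented_group_def)
  have "A = \<one>\<^bsub>presented_group ?P\<^esub>"
    if A: "A \<in> carrier (presented_group ?P)" and ker: "inclusion_map P A = \<one>\<^bsub>presented_group P\<^esub>" for A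
  proof -
    obtain u where u: "u \<in> words_over S" "A = word_rel ?P `` {u}"
      using A gens by (metis presented_group_cases)
    have "word_rel P `` {u} = word_rel P `` {[]}"
      using ker inclusion_map_class[OF P S u(1)] u(2) one by simp
    then have "word_equiv P u []"
      using eq_equiv_class[OF _ equiv_word_rel[OF P], of u "[]"] by (simp add: word_rel_def)
    then have "word_equiv ?P u []"
      by (rule trivial_word_in_sub_presentation[OF P assms(2) S u(1)])
    then show ?thesis
      using equiv_class_eq[OF equiv_word_rel[OF fin]] u(2) one by (simp add: word_rel_def)
  qed
  then show "inclusion_map P \<in> mon (presented_group ?P) (presented_group P)"
    using mon_iff_hom_one[OF group_presented_group[OF fin] group_presented_group[OF P]]
      inclusion_map_hom[OF P S] by blast
qed

end
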